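(* In the cut-matching game on $n$ vertices, there is a constant $C$ and a strategy for the matching player such that, against every strategy of the cut player, for every round $t\ge1$, $$\lambda_2(\mathcal L_{H^t})\le C\,\frac{\log\log n}{\log n}\cdot t.$$
   Context: The cut-matching game on vertex set $[n]$ ($n$ even) proceeds in rounds. In round $t$, the cut player chooses a bisection $(S^t,\overline{S^t})$ of $[n]$ (so $|S^t|=n/2$), and the matching player responds with a perfect matching $M^t$ pairing each $x\in S^t$ with some $y\in\overline{S^t}$. Let $H^t=M^1+\dots+M^t$ (multigraph sum of the matchings). For a graph $H$ with adjacency matrix $H$, $\mathcal L_H$ is its Laplacian (degree matrix minus adjacency matrix), and $\lambda_2(\mathcal L_H)$ is its second smallest eigenvalue.
   Formalization: The bound is stated for even n ≥ 4 with one absolute constant C; n = 2 is excluded because there log log n is not positive while λ₂ = 2t > 0, so no absolute constant could work. *)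

theory Defs
  imports Complex_Main "HOL-Library.Multiset" "Jordan_Normal_Form.Char_Poly"
begin

text \<open>The vertex set \<open>[n]\<close> is represented as \<open>{..<n}\<close>, to agree with the index range of
  matrices. An edge is a two-element set of vertices; a multigraph is a multiset of edges.\<close>

type_synonym edge = "nat set"
type_synonym multigraph = "edge multiset"

definition adjacency_matrix :: "nat \<Rightarrow> multigraph \<Rightarrow> real mat" where
  "adjacency_matrix n H = mat n n (\<lambda>(i, j). real (count H {i, j}))"

definition degree_matrix :: "nat \<Rightarrow> multigraph \<Rightarrow> real mat" where
  "degree_matrix n H =
     mat n n (\<lambda>(i, j). if i = j then real (size {#e \<in># H. i \<in> e#}) else 0)"

definition laplacian :: "nat \<Rightarrow> multigraph \<Rightarrow> real mat" where
  "laplacian n H = degree_matrix n H - adjacency_matrix n H"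

text \<open>Eigenvalues are listed in increasing order, repeated according to their multiplicity as
  roots of the characteristic polynomial. For a symmetric real matrix of dimension \<open>n\<close> the list
  has length \<open>n\<close>, so position \<open>1\<close> (counting from \<open>0\<close>) holds the second smallest one.\<close>

definition sorted_eigenvalues :: "real mat \<Rightarrow> real list" where
  "sorted_eigenvalues A = sorted_list_of_multiset (proots (char_poly A))"

definition lambda2 :: "real mat \<Rightarrow> real" where
  "lambda2 A = sorted_eigenvalues A ! 1"

definition bisection :: "nat \<Rightarrow> nat set \<Rightarrow> bool" where
  "bisection n S \<longleftrightarrow> S \<subseteq> {..<n} \<and> card S = n div 2"

definition perfect_matching_across :: "nat \<Rightarrow> nat set \<Rightarrow> edge set \<Rightarrow> bool" where
  "perfect_matching_across n S M \<longleftrightarrow>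
     (\<forall>e\<in>M. \<exists>x\<in>S. \<exists>y\<in>{..<n} - S. e = {x, y}) \<and>
     (\<forall>v<n. \<exists>!e. e \<in> M \<and> v \<in> e)"

text \<open>A history records the cuts and matchings of the rounds played so far, oldest first.\<close>

type_synonym history = "(nat set \<times> edge set) list"
type_synonym cut_strategy = "history \<Rightarrow> nat set"
type_synonym matching_strategy = "history \<Rightarrow> nat set \<Rightarrow> edge set"

definition is_cut_strategy :: "nat \<Rightarrow> cut_strategy \<Rightarrow> bool" where
  "is_cut_strategy n \<kappa> \<longleftrightarrow> (\<forall>h. bisection n (\<kappa> h))"

definition is_matching_strategy :: "nat \<Rightarrow> matching_strategy \<Rightarrow> bool" where
  "is_matching_strategy n \<mu> \<longleftrightarrow>
     (\<forall>h S. bisection n S \<longrightarrow> perfect_matching_across n S (\<mu> h S))"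

primrec play :: "matching_strategy \<Rightarrow> cut_strategy \<Rightarrow> nat \<Rightarrow> history" where
  "play \<mu> \<kappa> 0 = []"
| "play \<mu> \<kappa> (Suc t) = (let h = play \<mu> \<kappa> t; S = \<kappa> h in h @ [(S, \<mu> h S)])"

definition matching_sum :: "history \<Rightarrow> multigraph" where
  "matching_sum h = (\<Sum>(S, M)\<leftarrow>h. mset_set M)"

end

theory Submission
  imports Defs "HOL-Analysis.Function_Topology"
begin

text \<open>Take \<open>d\<close> with \<open>d ^ d \<le> n\<close> and \<open>d\<close> of order \<open>ln n / ln (ln n)\<close>, and place the vertices almost
  uniformly on the grid \<open>{0..<d}\<^sup>d\<close>. Each coordinate then has variance of order \<open>d\<^sup>2\<close>. The Poincare
  inequality on the grid shows that two sets of density \<open>p\<close> contain points at squared Euclidean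
  distance \<open>O(d\<^sup>2 / sqrt p)\<close>; as \<open>1 / sqrt p\<close> is integrable at \<open>0\<close>, matching closest pairs greedily
  across any bisection costs only \<open>O(d\<^sup>2)\<close> per vertex, summed over all \<open>d\<close> coordinates. Hence after
  \<open>t\<close> rounds some coordinate has Rayleigh quotient \<open>O(t / d)\<close>. The strategy ignores the history.\<close>

section \<open>Rayleigh quotients\<close>

text \<open>No test vector can be fixed in advance: a cut at the median of one coordinate forces
  energy of the order of its variance, \<open>k^2\<close> per vertex for a grid of side
  \<open>k\<close>, into that coordinate in every round. What stays cheap under every cut is the sum
  over all \<open>d\<close> coordinates. It is of the order of the variance of a single one and adds
  up over the rounds, so the good coordinate is picked by averaging only after round
  \<open>t\<close>. The side \<open>k\<close> cancels from the quotient, so \<open>d\<close> should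
  be as large as \<open>k ^ d \<le> n\<close> permits. But \<open>k\<close> cannot stay bounded: on
  a lattice of unit steps the distance to a set is smooth only after \<open>d\<close> is added to
  its square, and this \<open>d\<close> has to be absorbed into \<open>k^2\<close>. The condition
  \<open>d \<le> k^2\<close>, met here by \<open>k = d\<close>, is the origin of
  \<open>ln (ln n)\<close>. On the algebraic side \<open>lambda2\<close> is an entry in a list of
  roots that always contains 0. A mean-zero eigenvector may have eigenvalue 0 as well, so
  multiplicities are tracked through a factorisation of the characteristic polynomial.\<close>

lemma char_poly_column_sums_zero:
  fixes A :: "'a :: field mat"
  assumes A: "A \<in> carrier_mat n n" and n: "0 < n"
    and cols: "\<And>j. j < n \<Longrightarrow> (\<Sum>i<n. A $$ (i, j)) = 0"
  shows "char_poly A =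
    [:0, 1:] * det (mat n n (\<lambda>(i, j). if i = 0 then 1 else char_poly_matrix A $$ (i, j)))"
    (is "_ = _ * det ?M")
proof -
  let ?C = "char_poly_matrix A"
  \<comment> \<open>Multiplying by \<open>T\<close> adds all other rows to row 0. In
    \<open>char_poly_matrix A\<close> that turns row 0 into the constant row
    \<open>[:0, 1:]\<close>, a factor that can be pulled out of the determinant.\<close>
  define T :: "'a poly mat" where "T = mat n n (\<lambda>(i, j). if i = 0 \<or> i = j then 1 else 0)"
  have T: "T \<in> carrier_mat n n" and C: "?C \<in> carrier_mat n n" and M: "?M \<in> carrier_mat n n"
    using A by (auto simp: T_def)
  have "det T = prod_list (diag_mat T)"
    by (rule det_upper_triangular[OF _ T]) (auto simp: upper_triangular_def T_def)
  also have "diag_mat T = replicate n 1"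
    by (rule nth_equalityI) (auto simp: diag_mat_def T_def)
  finally have detT: "det T = 1"
    by simp
  have entry: "?C $$ (i, j) = (if i = j then [:0, 1:] else 0) + [:- (A $$ (i, j)):]"
    if "i < n" "j < n" for i j
    using that A by (auto simp: char_poly_matrix_def)
  have colsum: "(\<Sum>i<n. ?C $$ (i, j)) = [:0, 1:]" if j: "j < n" for j
  proof -
    have "(\<Sum>i<n. ?C $$ (i, j)) = (\<Sum>i<n. (if i = j then [:0, 1:] else 0)) + (\<Sum>i<n. [:- (A $$ (i, j)):])"
      using j by (simp add: entry sum.distrib)
    also have "(\<Sum>i<n. [:- (A $$ (i, j)):]) = [:- (\<Sum>i<n. A $$ (i, j)):]"
      by (induction n) auto
    finally show ?thesis
      using j cols[OF j] by simp
  qed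
  have "T * ?C = multrow 0 [:0, 1:] ?M"
  proof (rule eq_matI)
    fix i j assume "i < dim_row (multrow 0 [:0, 1:] ?M)" "j < dim_col (multrow 0 [:0, 1:] ?M)"
    then have ij: "i < n" "j < n" by auto
    have "(T * ?C) $$ (i, j) = (\<Sum>l<n. T $$ (i, l) * ?C $$ (l, j))"
      using ij T C by (auto simp: scalar_prod_def lessThan_atLeast0)
    also have "\<dots> = (\<Sum>l<n. (if i = 0 \<or> i = l then ?C $$ (l, j) else 0))"
      using ij by (intro sum.cong) (auto simp: T_def)
    also have "\<dots> = multrow 0 [:0, 1:] ?M $$ (i, j)"
      using ij colsum[of j] by (cases "i = 0") auto
    finally show "(T * ?C) $$ (i, j) = multrow 0 [:0, 1:] ?M $$ (i, j)" .
  qed (use T C in auto)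
  then have "det T * det ?C = [:0, 1:] * det ?M"
    using det_mult[OF T C] det_multrow[OF n M] by simp
  then show ?thesis
    by (simp add: detT char_poly_def)
qed

lemma nth_sorted_list_of_multiset_le:
  fixes c :: "'a :: linorder"
  assumes "{#a, b#} \<subseteq># M" "a \<le> c" "b \<le> c"
  shows "sorted_list_of_multiset M ! 1 \<le> c"
proof (rule ccontr)
  let ?xs = "sorted_list_of_multiset M"
  assume "\<not> ?xs ! 1 \<le> c"
  then have gt: "c < ?xs ! 1" by simp
  obtain N where M: "M = {#a, b#} + N"
    using assms(1) by (auto simp: subset_mset.le_iff_add)
  have "length ?xs = size M"
    using size_mset[of ?xs] by simp
  then have "2 \<le> length ?xs"
    by (simp add: M)
  then obtain u v ws where xs: "?xs = u # v # ws"
    by (auto simp: numeral_2_eq_2 Suc_le_length_iff)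
  have "sorted (u # v # ws)"
    using sorted_sorted_list_of_multiset[of M] unfolding xs .
  moreover have "c < v"
    using gt by (simp add: xs)
  ultimately have "\<not> w \<le> c" if "w \<in># mset (v # ws)" for w
    using that by auto
  then have "filter_mset (\<lambda>w. w \<le> c) (mset (v # ws)) = {#}"
    unfolding filter_mset_eq_mempty_iff by blast
  moreover have "mset (u # v # ws) = M"
    by (metis xs mset_sorted_list_of_multiset)
  ultimately have "size (filter_mset (\<lambda>w. w \<le> c) M) \<le> 1"
    by auto
  moreover have "2 \<le> size (filter_mset (\<lambda>w. w \<le> c) M)"
    using assms(2,3) by (simp add: M)
  ultimately show False
    by simp
qed

text \<open>Zero column sums contribute the root 0. For a second root, \<open>\<mu>\<close> must be
  a root of the remaining factor and not just of \<open>char_poly A\<close>, since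
  \<open>\<mu> = 0\<close> would have to count twice. At \<open>\<mu>\<close> that factor is the
  determinant of \<open>\<mu> I - A\<close> with row 0 replaced by ones, and the row of ones
  annihilates \<open>x\<close> because \<open>x\<close> has mean zero.\<close>

lemma lambda2_le_eigenvalue:
  assumes A: "A \<in> carrier_mat n n"
    and cols: "\<And>j. j < n \<Longrightarrow> (\<Sum>i<n. A $$ (i, j)) = 0"
    and x: "(\<Sum>i<n. x i) = 0" "m < n" "x m \<noteq> 0"
    and eig: "\<And>i. i < n \<Longrightarrow> (\<Sum>j<n. A $$ (i, j) * x j) = \<mu> * x i"
    and "\<mu> \<le> c" "0 \<le> c"
  shows "lambda2 A \<le> c"
proof -
  let ?M = "mat n n (\<lambda>(i, j). if i = 0 then 1 else char_poly_matrix A $$ (i, j))"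
  have n: "0 < n" using x(2) by simp
  let ?N = "mat n n (\<lambda>(i, j). if i = 0 then 1 else (if i = j then \<mu> else 0) - A $$ (i, j))"
  have cp: "char_poly A = [:0, 1:] * det ?M"
    by (rule char_poly_column_sums_zero[OF A n cols])
  have "?N *\<^sub>v vec n x = 0\<^sub>v n"
  proof (rule eq_vecI)
    fix i assume "i < dim_vec (0\<^sub>v n :: real vec)"
    then have i: "i < n" by simp
    have "(?N *\<^sub>v vec n x) $ i = (\<Sum>j<n. ?N $$ (i, j) * x j)"
      using i by (auto simp: scalar_prod_def lessThan_atLeast0 intro!: sum.cong)
    also have "\<dots> = 0"
    proof (cases "i = 0")
      case True
      then show ?thesis using i x(1) by simp
    next
      case False
      have "(\<Sum>j<n. ?N $$ (i, j) * x j) = (\<Sum>j<n. (if i = j then \<mu> * x j else 0) - A $$ (i, j) * x j)"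
        using i False by (intro sum.cong) (auto simp: algebra_simps)
      then show ?thesis
        using i eig[OF i] by (simp add: sum_subtractf)
    qed
    finally show "(?N *\<^sub>v vec n x) $ i = (0\<^sub>v n :: real vec) $ i" using i by simp
  qed simp
  moreover have "vec n x \<noteq> 0\<^sub>v n"
    using x(2,3) by (metis index_vec index_zero_vec(1))
  ultimately have "det ?N = 0"
    using det_0_iff_vec_prod_zero[OF mat_carrier] vec_carrier by blast
  moreover have "poly (det ?M) \<mu> = det ?N"
    by (rule poly_det_cong[of _ n]) (use A in \<open>auto simp: char_poly_matrix_def\<close>)
  ultimately have root: "poly (det ?M) \<mu> = 0"
    by simp
  have "char_poly A \<noteq> 0"
    using degree_monic_char_poly[OF A] by auto
  then have nz: "det ?M \<noteq> 0"
    using cp by auto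
  have "proots [:0, 1 :: real:] = {#0#}"
    using proots_linear_factor[of "0 :: real"] by simp
  then have "proots (char_poly A) = {#0#} + proots (det ?M)"
    unfolding cp using nz by (subst proots_mult) auto
  moreover have "\<mu> \<in># proots (det ?M)"
    using root nz by simp
  ultimately have "{#0, \<mu>#} \<subseteq># proots (char_poly A)"
    by simp
  then show ?thesis
    unfolding lambda2_def sorted_eigenvalues_def
    by (rule nth_sorted_list_of_multiset_le) (use assms in auto)
qed

lemma linear_coefficient_zero_if_quadratic_nonneg:
  fixes b c :: real
  assumes "\<And>t. 0 \<le> 2 * t * b + t\<^sup>2 * c"
  shows "b = 0"
proof (rule ccontr)
  assume b: "b \<noteq> 0"
  \<comment> \<open>The vertex of the parabola would be at \<open>- b / c\<close>;
    \<open>\<bar>c\<bar> + 1\<close> serves for \<open>c\<close> of either sign and for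
    \<open>c = 0\<close>.\<close>
  define t where "t = - b / (\<bar>c\<bar> + 1)"
  have "t\<^sup>2 * c \<le> t\<^sup>2 * (\<bar>c\<bar> + 1)"
    by (intro mult_left_mono) auto
  also have "\<dots> = - t * b"
    by (simp add: t_def power2_eq_square)
  finally have "0 \<le> t * b"
    using assms[of t] by simp
  moreover have "t * b < 0"
  proof -
    have "0 < b\<^sup>2 / (\<bar>c\<bar> + 1)"
      using b by (intro divide_pos_pos) auto
    then show ?thesis
      by (simp add: t_def power2_eq_square)
  qed
  ultimately show False by simp
qed

text \<open>Minimising the quadratic form over the unit sphere of the mean-zero hyperplane produces the
  eigenvector; the hyperplane is invariant because the columns sum to zero.\<close>

lemma mean_zero_eigenvector_le_rayleigh:
  fixes a :: "nat \<Rightarrow> nat \<Rightarrow> real"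
  assumes sym: "\<And>i j. i < n \<Longrightarrow> j < n \<Longrightarrow> a i j = a j i"
    and cols: "\<And>j. j < n \<Longrightarrow> (\<Sum>i<n. a i j) = 0"
    and y: "(\<Sum>i<n. y i) = 0" "m < n" "y m \<noteq> 0"
    and le: "(\<Sum>i<n. \<Sum>j<n. y i * a i j * y j) \<le> c * (\<Sum>i<n. (y i)\<^sup>2)"
  shows "\<exists>x \<mu>. (\<Sum>i<n. x i) = 0 \<and> (\<exists>m<n. x m \<noteq> 0) \<and> \<mu> \<le> c \<and>
    (\<forall>i<n. (\<Sum>j<n. a i j * x j) = \<mu> * x i)"
proof -
  define q where "q x = (\<Sum>i<n. \<Sum>j<n. x i * a i j * x j)" for x :: "nat \<Rightarrow> real"
  \<comment> \<open>Vectors are functions on all of \<open>nat\<close>. Pinning the entries from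
    \<open>n\<close> on to 0 makes the box compact by Tychonoff, and the unit sphere fits inside
    it.\<close>
  define K where "K = PiE UNIV (\<lambda>i. if i < n then {-1..1} else {0 :: real})
    \<inter> {x. (\<Sum>i<n. x i) = 0} \<inter> {x. (\<Sum>i<n. (x i)\<^sup>2) = 1}"
  have "compact (PiE UNIV (\<lambda>i. if i < n then {-1..1} else {0 :: real}))"
    using compactin_PiE[of "\<lambda>_. euclidean" UNIV "\<lambda>i. if i < n then {-1..1} else {0 :: real}"]
    unfolding euclidean_product_topology by simp
  moreover have "closed {x :: nat \<Rightarrow> real. (\<Sum>i<n. x i) = 0}"
    by (intro closed_Collect_eq continuous_intros) simp
  moreover have "closed {x :: nat \<Rightarrow> real. (\<Sum>i<n. (x i)\<^sup>2) = 1}"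
    by (intro closed_Collect_eq continuous_intros) simp
  ultimately have "compact K"
    unfolding K_def by (intro compact_Int_closed)
  have scale: "\<exists>u\<in>K. q z = (\<Sum>i<n. (z i)\<^sup>2) * q u"
    if z: "(\<Sum>i<n. z i) = 0" "i0 < n" "z i0 \<noteq> 0" for z i0
  proof -
    define s where "s = (\<Sum>i<n. (z i)\<^sup>2)"
    have "0 < s"
      unfolding s_def using z by (intro sum_pos2[of _ i0]) auto
    define u where "u i = (if i < n then z i / sqrt s else 0)" for i
    have "(\<Sum>i<n. (u i)\<^sup>2) = (\<Sum>i<n. (z i)\<^sup>2 / s)"
      using \<open>0 < s\<close> by (intro sum.cong) (auto simp: u_def power_divide)
    also have "\<dots> = 1"
      using \<open>0 < s\<close> by (simp add: sum_divide_distrib[symmetric] s_def[symmetric])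
    finally have u1: "(\<Sum>i<n. (u i)\<^sup>2) = 1" .
    have "(u i)\<^sup>2 \<le> 1" if "i < n" for i
      using member_le_sum[of i "{..<n}" "\<lambda>i. (u i)\<^sup>2"] that u1 by simp
    then have "u i \<in> {-1..1}" if "i < n" for i
      using that abs_square_le_1[of "u i"] by (auto simp: abs_le_iff)
    moreover have "(\<Sum>i<n. u i) = (\<Sum>i<n. z i) / sqrt s"
      by (simp add: u_def sum_divide_distrib)
    ultimately have "u \<in> K"
      using z(1) u1 by (auto simp: K_def u_def)
    moreover have "q z = s * q u"
      unfolding q_def sum_distrib_left using \<open>0 < s\<close>
      by (intro sum.cong refl) (auto simp: u_def field_simps)
    ultimately show ?thesis
      unfolding s_def by blast
  qed
  then have "K \<noteq> {}"
    using y by blast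
  moreover have "continuous_on K q"
    unfolding q_def
    by (intro continuous_intros continuous_on_subset[OF continuous_on_product_coordinates]) auto
  ultimately obtain x where x: "x \<in> K" and xmin: "\<And>u. u \<in> K \<Longrightarrow> q x \<le> q u"
    using continuous_attains_inf[OF \<open>compact K\<close>] by blast
  define \<mu> where "\<mu> = q x"
  have x0: "(\<Sum>i<n. x i) = 0" and x1: "(\<Sum>i<n. (x i)\<^sup>2) = 1"
    using x by (auto simp: K_def)
  have bound: "\<mu> * (\<Sum>i<n. (z i)\<^sup>2) \<le> q z" if z: "(\<Sum>i<n. z i) = 0" for z
  proof (cases "\<exists>i<n. z i \<noteq> 0")
    case True
    then obtain u where "u \<in> K" "q z = (\<Sum>i<n. (z i)\<^sup>2) * q u"
      using scale z by blast
    then show ?thesis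
      using xmin[of u] by (simp add: \<mu>_def mult.commute mult_right_mono sum_nonneg)
  next
    case False
    then show ?thesis by (simp add: q_def)
  qed
  have "0 < (\<Sum>i<n. (y i)\<^sup>2)"
    using y by (intro sum_pos2[of _ m]) auto
  moreover have "\<mu> * (\<Sum>i<n. (y i)\<^sup>2) \<le> c * (\<Sum>i<n. (y i)\<^sup>2)"
    using bound[OF y(1)] le unfolding q_def by linarith
  ultimately have "\<mu> \<le> c"
    by simp
  \<comment> \<open>The residual \<open>w\<close> is an admissible direction because it has mean
    zero. Moving from \<open>x\<close> along it changes \<open>q z - \<mu> |z|^2\<close>, which is
    never negative, with linear coefficient twice the squared norm of \<open>w\<close>; hence
    \<open>w\<close> vanishes.\<close>
  define w where "w i = (\<Sum>j<n. a i j * x j) - \<mu> * x i" for i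
  have w0: "(\<Sum>i<n. w i) = 0"
  proof -
    have "(\<Sum>i<n. \<Sum>j<n. a i j * x j) = (\<Sum>j<n. (\<Sum>i<n. a i j) * x j)"
      by (subst sum.swap) (simp add: sum_distrib_right)
    also have "\<dots> = 0" by (simp add: cols)
    finally show ?thesis
      by (simp add: w_def sum_subtractf sum_distrib_left[symmetric] x0)
  qed
  have "(\<Sum>i<n. (w i)\<^sup>2) = 0"
  proof (rule linear_coefficient_zero_if_quadratic_nonneg)
    fix t :: real
    define z where "z i = x i + t * w i" for i
    have "(\<Sum>i<n. z i) = 0"
      by (simp add: z_def sum.distrib sum_distrib_left[symmetric] x0 w0)
    then have *: "0 \<le> q z - \<mu> * (\<Sum>i<n. (z i)\<^sup>2)"
      using bound by simp
    have cross: "(\<Sum>i<n. \<Sum>j<n. x i * a i j * w j) = (\<Sum>i<n. \<Sum>j<n. w i * a i j * x j)"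
      by (subst sum.swap) (auto intro!: sum.cong simp: sym)
    have "q z = q x + t * (\<Sum>i<n. \<Sum>j<n. w i * a i j * x j)
        + t * (\<Sum>i<n. \<Sum>j<n. x i * a i j * w j) + t\<^sup>2 * q w"
      unfolding q_def z_def sum_distrib_left sum.distrib[symmetric]
      by (intro sum.cong refl) (simp add: algebra_simps power2_eq_square)
    then have qz: "q z = \<mu> + 2 * t * (\<Sum>i<n. \<Sum>j<n. w i * a i j * x j) + t\<^sup>2 * q w"
      unfolding cross \<mu>_def by simp
    have "(\<Sum>i<n. (z i)\<^sup>2) = (\<Sum>i<n. (x i)\<^sup>2) + 2 * t * (\<Sum>i<n. w i * x i) + t\<^sup>2 * (\<Sum>i<n. (w i)\<^sup>2)"
      unfolding z_def sum_distrib_left sum.distrib[symmetric]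
      by (intro sum.cong refl) (simp add: algebra_simps power2_eq_square)
    then have zz: "(\<Sum>i<n. (z i)\<^sup>2) = 1 + 2 * t * (\<Sum>i<n. w i * x i) + t\<^sup>2 * (\<Sum>i<n. (w i)\<^sup>2)"
      by (simp add: x1)
    have "(w i)\<^sup>2 = (\<Sum>j<n. w i * a i j * x j) - \<mu> * (w i * x i)" for i
    proof -
      have "(w i)\<^sup>2 = w i * ((\<Sum>j<n. a i j * x j) - \<mu> * x i)"
        by (simp add: power2_eq_square w_def)
      also have "\<dots> = w i * (\<Sum>j<n. a i j * x j) - \<mu> * (w i * x i)"
        by (simp add: algebra_simps)
      finally show ?thesis
        by (simp add: sum_distrib_left mult.assoc)
    qed
    then have ww: "(\<Sum>i<n. (w i)\<^sup>2) = (\<Sum>i<n. \<Sum>j<n. w i * a i j * x j) - \<mu> * (\<Sum>i<n. w i * x i)"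
      by (simp add: sum_subtractf sum_distrib_left)
    have "q z - \<mu> * (\<Sum>i<n. (z i)\<^sup>2)
        = 2 * t * (\<Sum>i<n. (w i)\<^sup>2) + t\<^sup>2 * (q w - \<mu> * (\<Sum>i<n. (w i)\<^sup>2))"
      unfolding qz zz by (subst (2) ww) (simp add: algebra_simps)
    then show "0 \<le> 2 * t * (\<Sum>i<n. (w i)\<^sup>2) + t\<^sup>2 * (q w - \<mu> * (\<Sum>i<n. (w i)\<^sup>2))"
      using * by simp
  qed
  then have "\<forall>i<n. w i = 0"
    by (simp add: sum_nonneg_eq_0_iff)
  moreover have "\<exists>m<n. x m \<noteq> 0"
  proof (rule ccontr)
    assume "\<not> (\<exists>m<n. x m \<noteq> 0)"
    then have "(\<Sum>i<n. (x i)\<^sup>2) = 0" by simp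
    then show False using x1 by simp
  qed
  ultimately show ?thesis
    using x0 \<open>\<mu> \<le> c\<close> unfolding w_def by (intro exI[of _ x] exI[of _ \<mu>]) auto
qed

lemma lambda2_le_rayleigh:
  assumes A: "A \<in> carrier_mat n n"
    and sym: "\<And>i j. i < n \<Longrightarrow> j < n \<Longrightarrow> A $$ (i, j) = A $$ (j, i)"
    and cols: "\<And>j. j < n \<Longrightarrow> (\<Sum>i<n. A $$ (i, j)) = 0"
    and y: "(\<Sum>i<n. y i) = 0" "m < n" "y m \<noteq> 0"
    and le: "(\<Sum>i<n. \<Sum>j<n. y i * A $$ (i, j) * y j) \<le> c * (\<Sum>i<n. (y i)\<^sup>2)"
    and "0 \<le> c"
  shows "lambda2 A \<le> c"
proof -
  obtain x \<mu> m' where "(\<Sum>i<n. x i) = 0" "m' < n" "x m' \<noteq> 0" "\<mu> \<le> c"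
    "\<And>i. i < n \<Longrightarrow> (\<Sum>j<n. A $$ (i, j) * x j) = \<mu> * x i"
    using mean_zero_eigenvector_le_rayleigh[OF sym cols y le] by auto
  then show ?thesis
    using lambda2_le_eigenvalue[OF A cols] \<open>0 \<le> c\<close> by blast
qed

section \<open>The Poincare inequality on a grid\<close>

lemma sum_square_differences:
  fixes f :: "'a \<Rightarrow> real"
  shows "(\<Sum>x\<in>S. \<Sum>y\<in>S. (f x - f y)\<^sup>2) = 2 * real (card S) * (\<Sum>x\<in>S. (f x)\<^sup>2) - 2 * (\<Sum>x\<in>S. f x)\<^sup>2"
proof -
  have "(\<Sum>x\<in>S. \<Sum>y\<in>S. (f x - f y)\<^sup>2)
      = (\<Sum>x\<in>S. \<Sum>y\<in>S. (f x)\<^sup>2 + (f y)\<^sup>2 - 2 * (f x * f y))"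
    by (intro sum.cong refl) (simp add: power2_eq_square algebra_simps)
  also have "\<dots> = real (card S) * (\<Sum>x\<in>S. (f x)\<^sup>2) + real (card S) * (\<Sum>x\<in>S. (f x)\<^sup>2)
      - 2 * ((\<Sum>x\<in>S. f x) * (\<Sum>y\<in>S. f y))"
    unfolding sum_product by (simp add: sum.distrib sum_subtractf sum_distrib_left[symmetric])
  finally show ?thesis
    by (simp add: power2_eq_square)
qed

lemma square_sum_le_card_mult_sum_squares:
  fixes f :: "'a \<Rightarrow> real"
  shows "(\<Sum>x\<in>S. f x)\<^sup>2 \<le> real (card S) * (\<Sum>x\<in>S. (f x)\<^sup>2)"
proof -
  have "0 \<le> (\<Sum>x\<in>S. \<Sum>y\<in>S. (f x - f y)\<^sup>2)"
    by (intro sum_nonneg) auto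
  then show ?thesis
    by (simp add: sum_square_differences)
qed

text \<open>The left side is the sum of \<open>(g u - g v)^2\<close> over all pairs, divided by
  \<open>2 * k\<close>. Each difference telescopes along the path and Cauchy-Schwarz costs a factor
  of at most \<open>k\<close>. The constant is not sharp; only the order \<open>k^2\<close>
  matters.\<close>

lemma poincare_path:
  fixes g :: "nat \<Rightarrow> real"
  assumes k: "0 < k"
  shows "(\<Sum>s<k. (g s)\<^sup>2) - (\<Sum>s<k. g s)\<^sup>2 / k \<le> (real k)\<^sup>2 / 2 * (\<Sum>s<k-1. (g (Suc s) - g s)\<^sup>2)"
proof -
  let ?E = "\<Sum>s<k-1. (g (Suc s) - g s)\<^sup>2"
  have E: "0 \<le> ?E" by (intro sum_nonneg) auto
  have ordered: "(g v - g u)\<^sup>2 \<le> real k * ?E" if uv: "u \<le> v" "v < k" for u v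
  proof -
    have "(g v - g u)\<^sup>2 = (\<Sum>s=u..<v. g (Suc s) - g s)\<^sup>2"
      using uv by (simp add: sum_Suc_diff')
    also have "\<dots> \<le> real (card {u..<v}) * (\<Sum>s=u..<v. (g (Suc s) - g s)\<^sup>2)"
      by (rule square_sum_le_card_mult_sum_squares)
    also have "\<dots> \<le> real k * ?E"
      using uv by (intro mult_mono sum_mono2) (auto intro: sum_nonneg)
    finally show ?thesis .
  qed
  have pair: "(g u - g v)\<^sup>2 \<le> real k * ?E" if "u < k" "v < k" for u v
    using ordered[of u v] ordered[of v u] that by (cases "u \<le> v") (auto simp: power2_commute)
  have "(\<Sum>u<k. \<Sum>v<k. (g u - g v)\<^sup>2) \<le> (\<Sum>u<k. \<Sum>v<k. real k * ?E)"
    using pair by (intro sum_mono) auto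
  then have "2 * real k * (\<Sum>s<k. (g s)\<^sup>2) - 2 * (\<Sum>s<k. g s)\<^sup>2 \<le> real k * (real k * (real k * ?E))"
    by (simp add: sum_square_differences)
  then show ?thesis
    using k by (simp add: field_simps power2_eq_square)
qed

section \<open>Arithmetic of base \<open>k\<close> digits\<close>

definition digit :: "nat \<Rightarrow> nat \<Rightarrow> nat \<Rightarrow> nat" where
  "digit k j r = r div k ^ j mod k"

lemma digit_mod:
  assumes "0 < k" "j < d"
  shows "digit k j (r mod k ^ d) = digit k j r"
proof -
  have "k ^ d = k ^ j * k ^ (d - j)"
    using assms by (simp flip: power_add)
  then have "r mod k ^ d div k ^ j = r div k ^ j mod k ^ (d - j)"
    using assms by (simp add: mod_mult2_eq)
  moreover have "k dvd k ^ (d - j)"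
    using assms by (intro dvd_power) auto
  ultimately show ?thesis
    by (simp add: digit_def mod_mod_cancel)
qed

lemma digit_add_low: "0 < k \<Longrightarrow> j < d \<Longrightarrow> digit k j (s * k ^ d + q) = digit k j q"
  by (metis digit_mod mod_mult_self3)

lemma digit_add_top: "s < k \<Longrightarrow> q < k ^ d \<Longrightarrow> digit k d (s * k ^ d + q) = s"
  by (simp add: digit_def)

text \<open>Digit \<open>j\<close> is not maximal, so adding \<open>k ^ j\<close> causes no carry
  into higher digits.\<close>

lemma add_power_div_power:
  assumes "Suc (digit k j r) < k" "j < i"
  shows "(r + k ^ j) div k ^ i = r div k ^ i"
proof -
  have k: "0 < k" using assms(1) by simp
  obtain m where i: "i = j + (1 + m)"
    using assms(2) by (metis Suc_eq_plus1_left less_iff_Suc_add add_Suc_right)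
  have *: "x div k ^ i = x div k ^ j div k div k ^ m" for x
    unfolding i power_add power_one_right div_mult2_eq ..
  have "Suc (r div k ^ j) mod k \<noteq> 0"
    using assms(1) by (simp add: digit_def mod_Suc)
  then have "Suc (r div k ^ j) div k = r div k ^ j div k"
    by (simp add: div_Suc)
  then show ?thesis
    using k by (simp add: *)
qed

lemma digit_add_power:
  assumes "Suc (digit k j r) < k"
  shows "digit k i (r + k ^ j) = (if i = j then Suc (digit k j r) else digit k i r)"
proof -
  have k: "0 < k" using assms by simp
  consider "i < j" | "i = j" | "j < i" by linarith
  then show ?thesis
  proof cases
    case 1
    then show ?thesis
      using digit_add_low[OF k 1, of 1 r] by (simp add: add.commute)
  next
    case 2
    then show ?thesis
      using assms k by (simp add: digit_def mod_Suc)
  next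
    case 3
    then show ?thesis
      using add_power_div_power[OF assms 3] by (simp add: digit_def)
  qed
qed

lemma add_power_less:
  assumes "r < k ^ d" "j < d" "Suc (digit k j r) < k"
  shows "r + k ^ j < k ^ d"
  using add_power_div_power[OF assms(3,2)] assms(1,3) by (simp add: div_eq_0_iff)

lemma sum_lessThan_mult:
  fixes g :: "nat \<Rightarrow> 'a :: comm_monoid_add"
  shows "(\<Sum>r<k * N. g r) = (\<Sum>s<k. \<Sum>q<N. g (s * N + q))"
proof -
  have "(\<Sum>r<k * N. g r) = (\<Sum>s<k. sum g {s * N..<s * N + N})"
    by (simp add: sum.nat_group)
  also have "\<dots> = (\<Sum>s<k. \<Sum>q<N. g (s * N + q))"
  proof (rule sum.cong[OF refl])
    fix s
    show "sum g {s * N..<s * N + N} = (\<Sum>q<N. g (s * N + q))"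
      using sum.shift_bounds_nat_ivl[of g 0 "s * N" N]
      by (simp add: lessThan_atLeast0 add.commute)
  qed
  finally show ?thesis .
qed

text \<open>The grid \<open>{0..<k}\<^sup>d\<close> is coded by \<open>{..<k ^ d}\<close> through base \<open>k\<close> digits, and an edge in
  direction \<open>j\<close> joins \<open>r\<close> to \<open>r + k ^ j\<close>.\<close>

definition grid_energy :: "nat \<Rightarrow> nat \<Rightarrow> (nat \<Rightarrow> real) \<Rightarrow> real" where
  "grid_energy k d f =
     (\<Sum>j<d. \<Sum>r<k ^ d. if Suc (digit k j r) < k then (f (r + k ^ j) - f r)\<^sup>2 else 0)"

text \<open>Variance tensorises. Splitting off the leading digit \<open>s\<close>, the total is the
  variance inside the slices, bounded by induction along the lower directions, plus the variance of
  the slice sums \<open>F\<close>, bounded by \<open>poincare_path\<close> and Cauchy-Schwarz along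
  the new direction. Each direction is used once, so the constant does not grow with
  \<open>d\<close>.\<close>

lemma poincare_grid:
  fixes f :: "nat \<Rightarrow> real"
  assumes k: "0 < k"
  shows "(\<Sum>r<k ^ d. (f r)\<^sup>2) - (\<Sum>r<k ^ d. f r)\<^sup>2 / k ^ d \<le> (real k)\<^sup>2 / 2 * grid_energy k d f"
proof (induction d arbitrary: f)
  case 0
  then show ?case by (simp add: grid_energy_def)
next
  case (Suc d)
  define N where "N = k ^ d"
  have N: "0 < N" using k by (simp add: N_def)
  define f' where "f' s q = f (s * N + q)" for s q
  define F where "F s = (\<Sum>q<N. f' s q)" for s
  let ?top = "\<Sum>s<k-1. \<Sum>q<N. (f' (Suc s) q - f' s q)\<^sup>2"
  have "grid_energy k (Suc d) f = (\<Sum>s<k. grid_energy k d (f' s)) + ?top"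
  proof -
    have low: "(\<Sum>r<k ^ Suc d. if Suc (digit k j r) < k then (f (r + k ^ j) - f r)\<^sup>2 else 0)
       = (\<Sum>s<k. \<Sum>q<k ^ d. if Suc (digit k j q) < k then (f' s (q + k ^ j) - f' s q)\<^sup>2 else 0)"
      if "j < d" for j
      unfolding power_Suc sum_lessThan_mult using that
      by (intro sum.cong refl) (auto simp: f'_def N_def digit_add_low[OF k] add.assoc)
    have "(\<Sum>r<k ^ Suc d. if Suc (digit k d r) < k then (f (r + k ^ d) - f r)\<^sup>2 else 0)
       = (\<Sum>s<k. \<Sum>q<N. if Suc s < k then (f' (Suc s) q - f' s q)\<^sup>2 else 0)"
      unfolding power_Suc sum_lessThan_mult N_def
      by (intro sum.cong refl) (simp add: digit_add_top, simp add: f'_def N_def add_ac)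
    also have "\<dots> = (\<Sum>s<k. if Suc s < k then (\<Sum>q<N. (f' (Suc s) q - f' s q)\<^sup>2) else 0)"
      by (intro sum.cong) auto
    also have "\<dots> = (\<Sum>s\<in>{..<k} \<inter> {s. Suc s < k}. \<Sum>q<N. (f' (Suc s) q - f' s q)\<^sup>2)"
      by (subst sum.inter_restrict) (auto intro!: sum.cong)
    also have "{..<k} \<inter> {s. Suc s < k} = {..<k-1}"
      by auto
    finally have top: "(\<Sum>r<k ^ Suc d. if Suc (digit k d r) < k then (f (r + k ^ d) - f r)\<^sup>2 else 0) = ?top" .
    show ?thesis
      unfolding grid_energy_def sum.lessThan_Suc top
      by (simp add: low sum.swap[of _ "{..<k}" "{..<d}"] del: power_Suc cong: sum.cong_simp)
  qed
  moreover have "(\<Sum>s<k. \<Sum>q<N. (f' s q)\<^sup>2) - (\<Sum>s<k. (F s)\<^sup>2 / N)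
      \<le> (real k)\<^sup>2 / 2 * (\<Sum>s<k. grid_energy k d (f' s))"
    unfolding sum_subtractf[symmetric] sum_distrib_left
    using Suc.IH by (intro sum_mono) (simp add: F_def N_def)
  moreover have "(\<Sum>s<k. (F s)\<^sup>2 / N) - (\<Sum>s<k. F s)\<^sup>2 / (k * N) \<le> (real k)\<^sup>2 / 2 * ?top"
  proof -
    have "(\<Sum>s<k. (F s)\<^sup>2 / N) - (\<Sum>s<k. F s)\<^sup>2 / (k * N)
        = ((\<Sum>s<k. (F s)\<^sup>2) - (\<Sum>s<k. F s)\<^sup>2 / k) / N"
      using N k by (simp add: sum_divide_distrib[symmetric] diff_divide_distrib)
    also have "\<dots> \<le> (real k)\<^sup>2 / 2 * (\<Sum>s<k-1. (F (Suc s) - F s)\<^sup>2) / N"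
      by (intro divide_right_mono poincare_path k) auto
    also have "\<dots> = (real k)\<^sup>2 / 2 * (\<Sum>s<k-1. (F (Suc s) - F s)\<^sup>2 / N)"
      by (simp flip: sum_divide_distrib)
    also have "\<dots> \<le> (real k)\<^sup>2 / 2 * ?top"
    proof (intro mult_left_mono sum_mono)
      fix s
      have "(F (Suc s) - F s)\<^sup>2 \<le> N * (\<Sum>q<N. (f' (Suc s) q - f' s q)\<^sup>2)"
        using square_sum_le_card_mult_sum_squares[of "\<lambda>q. f' (Suc s) q - f' s q" "{..<N}"]
        by (simp add: F_def sum_subtractf)
      then show "(F (Suc s) - F s)\<^sup>2 / N \<le> (\<Sum>q<N. (f' (Suc s) q - f' s q)\<^sup>2)"
        using N by (simp add: divide_le_eq mult.commute)
    qed auto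
    finally show ?thesis .
  qed
  moreover have "(\<Sum>r<k ^ Suc d. (f r)\<^sup>2) = (\<Sum>s<k. \<Sum>q<N. (f' s q)\<^sup>2)"
    "(\<Sum>r<k ^ Suc d. f r) = (\<Sum>s<k. F s)"
    unfolding power_Suc sum_lessThan_mult N_def F_def f'_def by simp_all
  moreover have "real (k ^ Suc d) = real (k * N)"
    by (simp add: N_def)
  ultimately show ?case
    by (simp only: distrib_left)
qed

section \<open>Expansion of the grid\<close>

definition sqdist :: "nat \<Rightarrow> nat \<Rightarrow> nat \<Rightarrow> nat \<Rightarrow> real" where
  "sqdist k d a b = (\<Sum>j<d. (real (digit k j a) - real (digit k j b))\<^sup>2)"

lemma sqdist_nonneg: "0 \<le> sqdist k d a b"
  unfolding sqdist_def by (intro sum_nonneg) auto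

lemma sqdist_self: "sqdist k d a a = 0"
  by (simp add: sqdist_def)

lemma sqdist_commute: "sqdist k d a b = sqdist k d b a"
  by (simp add: sqdist_def power2_commute)

lemma sqdist_mod:
  assumes "0 < k"
  shows "sqdist k d (a mod k ^ d) (b mod k ^ d) = sqdist k d a b"
  unfolding sqdist_def using assms by (intro sum.cong) (auto simp: digit_mod)

lemma sqdist_neighbour:
  assumes j: "j < d" and other: "\<And>i. i \<noteq> j \<Longrightarrow> digit k i v = digit k i u"
    and step: "\<bar>real (digit k j v) - real (digit k j u)\<bar> = 1"
  shows "sqdist k d c v \<le> sqdist k d c u + 2 * \<bar>real (digit k j c) - real (digit k j u)\<bar> + 1"
proof -
  have split: "sqdist k d c w = (real (digit k j c) - real (digit k j w))\<^sup>2
      + (\<Sum>i\<in>{..<d} - {j}. (real (digit k i c) - real (digit k i w))\<^sup>2)" for w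
    unfolding sqdist_def using j by (subst sum.remove[of _ j]) auto
  have "(\<Sum>i\<in>{..<d} - {j}. (real (digit k i c) - real (digit k i v))\<^sup>2)
      = (\<Sum>i\<in>{..<d} - {j}. (real (digit k i c) - real (digit k i u))\<^sup>2)"
    by (intro sum.cong) (auto simp: other)
  moreover have "(real (digit k j c) - real (digit k j v))\<^sup>2
      \<le> (real (digit k j c) - real (digit k j u))\<^sup>2 + 2 * \<bar>real (digit k j c) - real (digit k j u)\<bar> + 1"
  proof -
    define x where "x = real (digit k j c) - real (digit k j u)"
    define y where "y = real (digit k j v) - real (digit k j u)"
    have y: "y = 1 \<or> y = -1" using step by (auto simp: y_def)
    have "(x - y)\<^sup>2 \<le> x\<^sup>2 + 2 * \<bar>x\<bar> + 1"
      using y by (auto simp: power2_eq_square algebra_simps)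
    then show ?thesis by (simp add: x_def y_def)
  qed
  ultimately show ?thesis
    by (simp add: split)
qed

lemma sqrt_diff_square_le:
  fixes x y :: real
  assumes "0 < x" "x \<le> y"
  shows "(sqrt y - sqrt x)\<^sup>2 \<le> (y - x)\<^sup>2 / (4 * x)"
proof -
  have "4 * x = (2 * sqrt x)\<^sup>2"
    using assms by (simp add: power_mult_distrib)
  also have "\<dots> \<le> (sqrt y + sqrt x)\<^sup>2"
    using assms by (intro power_mono) auto
  finally have "(sqrt y - sqrt x)\<^sup>2 * (4 * x) \<le> (sqrt y - sqrt x)\<^sup>2 * (sqrt y + sqrt x)\<^sup>2"
    by (intro mult_left_mono) auto
  also have "\<dots> = ((sqrt y - sqrt x) * (sqrt y + sqrt x))\<^sup>2"
    by (simp add: power_mult_distrib)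
  also have "(sqrt y - sqrt x) * (sqrt y + sqrt x) = y - x"
    using assms by (simp add: algebra_simps)
  finally show ?thesis
    using assms by (simp add: pos_le_divide_eq)
qed

text \<open>This is the energy of one grid edge: \<open>\<phi>\<close> and \<open>\<psi>\<close> are
  squared distances to a set at its two ends, \<open>\<delta>\<close> is the coordinate difference
  to a nearest point, \<open>e\<close> the smoothing term. Everything is charged to the end with the
  smaller value, so an edge beyond \<open>cap\<close> costs nothing. Separating
  \<open>\<delta>\<close> from the constant lets the numerators add up to a multiple of the squared
  distance plus a multiple of \<open>d\<close>.\<close>

lemma truncated_sqrt_increment:
  fixes \<phi> \<psi> \<delta> e cap :: real
  assumes "0 \<le> \<phi>" "\<phi> \<le> \<psi>" "\<psi> \<le> \<phi> + 2 * \<delta> + 1" "0 < e" "0 \<le> \<delta>"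
  shows "(min (sqrt (\<psi> + e)) cap - min (sqrt (\<phi> + e)) cap)\<^sup>2
    \<le> (if cap \<le> sqrt (\<phi> + e) then 0 else (2 * \<delta>\<^sup>2 + 1 / 2) / (\<phi> + e))"
proof -
  have mono: "sqrt (\<phi> + e) \<le> sqrt (\<psi> + e)"
    using assms by simp
  show ?thesis
  proof (cases "cap \<le> sqrt (\<phi> + e)")
    case True
    then have "min (sqrt (\<psi> + e)) cap = cap" "min (sqrt (\<phi> + e)) cap = cap"
      using mono by linarith+
    then show ?thesis using True by simp
  next
    case False
    have "(min (sqrt (\<psi> + e)) cap - min (sqrt (\<phi> + e)) cap)\<^sup>2 \<le> (sqrt (\<psi> + e) - sqrt (\<phi> + e))\<^sup>2"
      using mono False by (intro power_mono) auto
    also have "\<dots> \<le> ((\<psi> + e) - (\<phi> + e))\<^sup>2 / (4 * (\<phi> + e))"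
      using assms by (intro sqrt_diff_square_le) auto
    also have "\<dots> \<le> (2 * \<delta> + 1)\<^sup>2 / (4 * (\<phi> + e))"
      using assms by (intro divide_right_mono power_mono) auto
    also have "\<dots> \<le> (8 * \<delta>\<^sup>2 + 2) / (4 * (\<phi> + e))"
    proof (intro divide_right_mono)
      have "0 \<le> (2 * \<delta> - 1)\<^sup>2" by simp
      then show "(2 * \<delta> + 1)\<^sup>2 \<le> 8 * \<delta>\<^sup>2 + 2"
        by (simp add: power2_eq_square algebra_simps)
    qed (use assms in auto)
    also have "\<dots> = (2 * \<delta>\<^sup>2 + 1 / 2) / (\<phi> + e)"
      using assms by (simp add: field_simps)
    finally show ?thesis using False by simp
  qed
qed

text \<open>Adding \<open>d\<close> to the squared distance before taking the root makes the function smooth at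
  the scale of one grid step: its energy density is bounded independently of the dimension,
  because the increments in the \<open>d\<close> directions add up to the squared distance itself.\<close>

lemma grid_expansion:
  assumes k: "0 < k" and d: "0 < d" and A: "A \<subseteq> {..<k ^ d}" "A \<noteq> {}" and R: "0 < R"
    and B: "B = {b. b < k ^ d \<and> (\<forall>a\<in>A. (sqrt d + R)\<^sup>2 \<le> sqdist k d a b + d)}"
  shows "real (card A) * real (card B) * R\<^sup>2
    \<le> 2 * (real k)\<^sup>2 * real (k ^ d) * (real (k ^ d) - real (card B))"
proof -
  define N where "N = k ^ d"
  have finA: "finite A" using A finite_subset by blast
  have BN: "B \<subseteq> {..<N}" unfolding B N_def by auto
  then have finB: "finite B" using finite_subset by blast
  define \<phi> where "\<phi> r = Min ((\<lambda>a. sqdist k d a r) ` A)" for r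
  have "\<exists>c\<in>A. \<phi> r = sqdist k d c r" for r
    using Min_in[of "(\<lambda>a. sqdist k d a r) ` A"] finA A(2) unfolding \<phi>_def by blast
  then obtain c where cA: "\<And>r. c r \<in> A" and c: "\<And>r. \<phi> r = sqdist k d (c r) r"
    by metis
  have \<phi>_le: "\<phi> r \<le> sqdist k d a r" if "a \<in> A" for a r
    unfolding \<phi>_def using finA that by (intro Min_le) auto
  have \<phi>0: "0 \<le> \<phi> r" for r
    unfolding c by (rule sqdist_nonneg)
  define cap where "cap = sqrt d + R"
  define f where "f r = min (sqrt (\<phi> r + d)) cap" for r
  \<comment> \<open>\<open>w j u\<close> bounds the squared increment of \<open>f\<close> on an edge
    in direction \<open>j\<close> whose end nearer to \<open>A\<close> is \<open>u\<close>. It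
    vanishes on \<open>B\<close>, which yields the factor \<open>N - card B\<close> in the
    energy.\<close>
  define w where "w j u = (if cap \<le> sqrt (\<phi> u + d) then 0
    else (2 * \<bar>real (digit k j (c u)) - real (digit k j u)\<bar>\<^sup>2 + 1 / 2) / (\<phi> u + d))" for j u
  have w0: "0 \<le> w j u" for j u
    using \<phi>0[of u] by (simp add: w_def)
  have capB: "cap \<le> sqrt (\<phi> r + d) \<longleftrightarrow> r \<in> B" if "r < N" for r
  proof -
    have "cap \<le> sqrt (\<phi> r + d) \<longleftrightarrow> cap\<^sup>2 \<le> \<phi> r + d"
      using R real_sqrt_le_iff[of "cap\<^sup>2" "\<phi> r + d"] by (simp add: cap_def)
    also have "\<dots> \<longleftrightarrow> (\<forall>a\<in>A. cap\<^sup>2 \<le> sqdist k d a r + d)"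
      using \<phi>_le[of _ r] c[of r] cA[of r] by (auto intro: order_trans)
    finally show ?thesis
      using that by (simp add: B cap_def N_def)
  qed
  have half: "(f v - f u)\<^sup>2 \<le> w j u"
    if "j < d" "\<And>i. i \<noteq> j \<Longrightarrow> digit k i v = digit k i u"
      "\<bar>real (digit k j v) - real (digit k j u)\<bar> = 1" "\<phi> u \<le> \<phi> v" for j u v
  proof -
    have "\<phi> v \<le> sqdist k d (c u) v"
      by (rule \<phi>_le[OF cA])
    also have "\<dots> \<le> \<phi> u + 2 * \<bar>real (digit k j (c u)) - real (digit k j u)\<bar> + 1"
      unfolding c[of u] by (rule sqdist_neighbour) (use that in auto)
    finally show ?thesis
      unfolding f_def w_def
      by (intro truncated_sqrt_increment) (use \<phi>0 that(4) d in auto)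
  qed
  \<comment> \<open>Which end is nearer to \<open>A\<close> varies from edge to edge, so both ends
    are charged; this doubles the total.\<close>
  have edge: "(if Suc (digit k j r) < k then (f (r + k ^ j) - f r)\<^sup>2 else 0)
      \<le> w j r + (if Suc (digit k j r) < k then w j (r + k ^ j) else 0)" if j: "j < d" for j r
  proof (cases "Suc (digit k j r) < k")
    case True
    note dig = digit_add_power[OF True]
    show ?thesis
    proof (cases "\<phi> r \<le> \<phi> (r + k ^ j)")
      case le: True
      have "(f (r + k ^ j) - f r)\<^sup>2 \<le> w j r"
        by (rule half[OF j]) (use le in \<open>auto simp: dig\<close>)
      then show ?thesis using True w0[of j "r + k ^ j"] by simp
    next
      case False
      have "(f r - f (r + k ^ j))\<^sup>2 \<le> w j (r + k ^ j)"
        by (rule half[OF j]) (use False in \<open>auto simp: dig\<close>)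
      then show ?thesis using True w0[of j r] by (simp add: power2_commute)
    qed
  qed (simp add: w0)
  have shifted: "(\<Sum>r<N. if Suc (digit k j r) < k then w j (r + k ^ j) else 0) \<le> (\<Sum>r<N. w j r)"
    if j: "j < d" for j
  proof -
    let ?I = "{..<N} \<inter> {r. Suc (digit k j r) < k}"
    have "(\<Sum>r<N. if Suc (digit k j r) < k then w j (r + k ^ j) else 0) = (\<Sum>r\<in>?I. w j (r + k ^ j))"
      by (simp add: sum.inter_restrict)
    also have "\<dots> = (\<Sum>r\<in>(\<lambda>r. r + k ^ j) ` ?I. w j r)"
      by (subst sum.reindex) (auto simp: inj_on_def)
    also have "\<dots> \<le> (\<Sum>r<N. w j r)"
      using add_power_less[of _ k d j] j w0 by (intro sum_mono2) (auto simp: N_def)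
    finally show ?thesis .
  qed
  have point: "(\<Sum>j<d. w j r) \<le> (if r \<in> B then 0 else 2)" if r: "r < N" for r
  proof (cases "r \<in> B")
    case True
    then show ?thesis using capB[OF r] by (simp add: w_def)
  next
    case False
    have "(\<Sum>j<d. w j r)
        = (\<Sum>j<d. (2 * (real (digit k j (c r)) - real (digit k j r))\<^sup>2 + 1 / 2) / (\<phi> r + d))"
      using False capB[OF r] by (simp add: w_def)
    also have "\<dots> = (2 * \<phi> r + d / 2) / (\<phi> r + d)"
      unfolding sum_divide_distrib[symmetric] sum.distrib sum_distrib_left[symmetric] c[of r] sqdist_def
      by simp
    also have "\<dots> \<le> 2"
      using \<phi>0[of r] d by (simp add: divide_le_eq)
    finally show ?thesis using False by simp
  qed
  have "grid_energy k d f \<le> (\<Sum>j<d. \<Sum>r<N. w j r + (if Suc (digit k j r) < k then w j (r + k ^ j) else 0))"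
    unfolding grid_energy_def N_def[symmetric] using edge by (intro sum_mono) auto
  also have "\<dots> \<le> (\<Sum>j<d. 2 * (\<Sum>r<N. w j r))"
    using shifted by (intro sum_mono) (fastforce simp: sum.distrib)
  also have "\<dots> = 2 * (\<Sum>r<N. \<Sum>j<d. w j r)"
    by (subst sum.swap) (simp add: sum_distrib_left)
  also have "\<dots> \<le> 2 * (\<Sum>r<N. if r \<in> B then 0 else 2)"
    using point by (intro mult_left_mono sum_mono) auto
  also have "(\<Sum>r<N. if r \<in> B then 0 else 2 :: real) = 2 * (real N - real (card B))"
  proof -
    have "(\<Sum>r<N. if r \<in> B then 0 else 2 :: real) = (\<Sum>r\<in>{..<N} - B. 2)"
      by (rule sum.mono_neutral_cong_right) auto
    then show ?thesis
      using BN finB card_mono[OF _ BN] by (simp add: card_Diff_subset of_nat_diff)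
  qed
  finally have energy: "grid_energy k d f \<le> 4 * (real N - real (card B))"
    by simp
  have fA: "f r = sqrt d" if "r \<in> A" for r
  proof -
    have "\<phi> r = 0"
      using \<phi>_le[OF that, of r] \<phi>0[of r] by (simp add: sqdist_self)
    then show ?thesis using R by (simp add: f_def cap_def)
  qed
  have fB: "f r = sqrt d + R" if "r \<in> B" for r
    using capB[of r] that BN by (auto simp: f_def cap_def min_def)
  have disj: "A \<inter> B = {}"
    using fA fB R by force
  \<comment> \<open>Since \<open>f\<close> is \<open>sqrt d\<close> on \<open>A\<close> and
    \<open>sqrt d + R\<close> on \<open>B\<close>, every pair from the two sets contributes
    \<open>R^2\<close> to the sum of squared differences, once in each order. The full sum is
    \<open>2 * N\<close> times the left side of the Poincare inequality.\<close>
  define g where "g x = (\<Sum>y<N. (f x - f y)\<^sup>2)" for x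
  have g0: "0 \<le> g x" for x
    unfolding g_def by (intro sum_nonneg) auto
  have gA: "real (card B) * R\<^sup>2 \<le> g x" if "x \<in> A" for x
  proof -
    have "(\<Sum>y\<in>B. R\<^sup>2) = (\<Sum>y\<in>B. (f x - f y)\<^sup>2)"
      using that by (intro sum.cong) (auto simp: fA fB)
    also have "\<dots> \<le> g x"
      unfolding g_def using BN by (intro sum_mono2) auto
    finally show ?thesis by simp
  qed
  have gB: "real (card A) * R\<^sup>2 \<le> g x" if "x \<in> B" for x
  proof -
    have "(\<Sum>y\<in>A. R\<^sup>2) = (\<Sum>y\<in>A. (f x - f y)\<^sup>2)"
      using that by (intro sum.cong) (auto simp: fA fB)
    also have "\<dots> \<le> g x"
      unfolding g_def using A by (intro sum_mono2) (auto simp: N_def)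
    finally show ?thesis by simp
  qed
  have "2 * (real (card A) * real (card B) * R\<^sup>2)
      = (\<Sum>x\<in>A. real (card B) * R\<^sup>2) + (\<Sum>x\<in>B. real (card A) * R\<^sup>2)"
    by simp
  also have "\<dots> \<le> (\<Sum>x\<in>A. g x) + (\<Sum>x\<in>B. g x)"
    using gA gB by (intro add_mono sum_mono) auto
  also have "\<dots> = (\<Sum>x\<in>A \<union> B. g x)"
    using finA finB disj by (simp add: sum.union_disjoint)
  also have "\<dots> \<le> (\<Sum>x<N. g x)"
    using A BN g0 by (intro sum_mono2) (auto simp: N_def)
  also have "\<dots> = 2 * real N * ((\<Sum>r<N. (f r)\<^sup>2) - (\<Sum>r<N. f r)\<^sup>2 / N)"
    unfolding g_def sum_square_differences using k by (simp add: N_def field_simps)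
  also have "\<dots> \<le> 2 * real N * ((real k)\<^sup>2 / 2 * (4 * (real N - real (card B))))"
  proof (rule mult_left_mono)
    have "(\<Sum>r<N. (f r)\<^sup>2) - (\<Sum>r<N. f r)\<^sup>2 / N \<le> (real k)\<^sup>2 / 2 * grid_energy k d f"
      unfolding N_def by (rule poincare_grid[OF k])
    also have "\<dots> \<le> (real k)\<^sup>2 / 2 * (4 * (real N - real (card B)))"
      by (intro mult_left_mono energy) auto
    finally show "(\<Sum>r<N. (f r)\<^sup>2) - (\<Sum>r<N. f r)\<^sup>2 / N \<le> (real k)\<^sup>2 / 2 * (4 * (real N - real (card B)))" .
  qed simp
  also have "\<dots> = 2 * (2 * (real k)\<^sup>2 * real N * (real N - real (card B)))"
    by simp
  finally show ?thesis
    unfolding N_def by (simp only: mult_le_cancel_left_pos zero_less_numeral)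
qed

text \<open>The complement of the set \<open>B\<close> of \<open>grid_expansion\<close>: a
  neighbourhood in the smoothed distance \<open>sqrt (sqdist + d)\<close>, measured from its minimum
  \<open>sqrt d\<close>.\<close>

definition nbhd :: "nat \<Rightarrow> nat \<Rightarrow> real \<Rightarrow> nat set \<Rightarrow> nat set" where
  "nbhd k d R A = {b. b < k ^ d \<and> (\<exists>a\<in>A. sqdist k d a b + d < (sqrt d + R)\<^sup>2)}"

lemma nbhd_subset: "nbhd k d R A \<subseteq> {..<k ^ d}"
  by (auto simp: nbhd_def)

lemma card_nbhd_ge:
  assumes "0 < k" "0 < d" "A \<subseteq> {..<k ^ d}" "A \<noteq> {}" "0 < R"
  shows "real (card A) * (real (k ^ d) - real (card (nbhd k d R A))) * R\<^sup>2
    \<le> 2 * (real k)\<^sup>2 * real (k ^ d) * real (card (nbhd k d R A))"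
proof -
  let ?B = "{b. b < k ^ d \<and> (\<forall>a\<in>A. (sqrt d + R)\<^sup>2 \<le> sqdist k d a b + d)}"
  have "?B = {..<k ^ d} - nbhd k d R A"
    by (auto simp: nbhd_def not_less)
  then have "real (card ?B) = real (k ^ d) - real (card (nbhd k d R A))"
    using card_Diff_subset[OF finite_subset[OF nbhd_subset] nbhd_subset]
      card_mono[OF _ nbhd_subset] by (simp add: of_nat_diff del: of_nat_power)
  then show ?thesis
    using grid_expansion[OF assms refl] by simp
qed

text \<open>A single step at this radius only brings density \<open>p\<close> up to order \<open>sqrt p\<close>; the second step
  takes it beyond \<open>1 / 2\<close>. Going there in one step would need \<open>R\<^sup>2\<close> of order \<open>k\<^sup>2 / p\<close>, and \<open>1 / p\<close>
  is not integrable.\<close>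

lemma nbhd_nbhd_more_than_half:
  assumes k: "0 < k" and d: "0 < d" and A: "A \<subseteq> {..<k ^ d}" and p: "0 < p"
    and cA: "p * real (k ^ d) \<le> real (card A)"
    and R: "0 < R" "R\<^sup>2 = 8 * (real k)\<^sup>2 / sqrt p"
  shows "real (k ^ d) < 2 * real (card (nbhd k d R (nbhd k d R A)))"
proof (rule ccontr)
  assume le_half: "\<not> ?thesis"
  define N where "N = real (k ^ d)"
  define s where "s = sqrt p"
  define \<alpha> where "\<alpha> = real (card A) / N"
  define \<gamma> where "\<gamma> = real (card (nbhd k d R A)) / N"
  define \<delta> where "\<delta> = real (card (nbhd k d R (nbhd k d R A))) / N"
  have N: "0 < N" using k by (simp add: N_def)
  have s: "0 < s" "p = s\<^sup>2" using p by (simp_all add: s_def)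
  have "card A \<le> k ^ d"
    using card_mono[OF _ A] by simp
  then have "real (card A) \<le> N" unfolding N_def by (simp only: of_nat_le_iff)
  then have "p * N \<le> 1 * N" using cA unfolding N_def by linarith
  then have "s \<le> 1"
    using N by (simp add: s_def)
  have "\<alpha> \<ge> s\<^sup>2"
    using cA N s by (simp add: \<alpha>_def le_divide_eq N_def)
  have "\<delta> \<le> 1 / 2"
    using le_half N by (simp add: \<delta>_def N_def divide_le_eq)
  have \<gamma>1: "\<gamma> \<le> 1"
    using card_mono[OF _ nbhd_subset, of k d R A] N
    by (simp add: \<gamma>_def divide_le_eq N_def)
  have A0: "A \<noteq> {}"
    using cA mult_pos_pos[OF p N] by (auto simp: N_def)
  \<comment> \<open>In terms of densities the chosen \<open>R\<close> removes \<open>k\<close> and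
    \<open>N\<close> from the expansion inequality; the 4 is the 8 in \<open>R^2\<close> over the 2
    in \<open>card_nbhd_ge\<close>.\<close>
  have reduce: "4 * x * (1 - y) \<le> s * y"
    if *: "real m * (N - real l) * R\<^sup>2 \<le> 2 * (real k)\<^sup>2 * N * real l"
      and x: "x = real m / N" and y: "y = real l / N" for m l x y
  proof -
    have ml: "real m = x * N" "real l = y * N"
      using N x y by auto
    have "(x * N) * (N - y * N) * (8 * (real k)\<^sup>2 / s) \<le> 2 * (real k)\<^sup>2 * N * (y * N)"
      using * unfolding ml R(2) s_def .
    then have "(2 * (real k)\<^sup>2 * N\<^sup>2 / s) * (4 * x * (1 - y)) \<le> (2 * (real k)\<^sup>2 * N\<^sup>2 / s) * (s * y)"
      using s(1) by (simp add: field_simps power2_eq_square)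
    moreover have "0 < 2 * (real k)\<^sup>2 * N\<^sup>2 / s"
      using k N s by simp
    ultimately show ?thesis
      by (simp only: mult_le_cancel_left_pos)
  qed
  have 1: "4 * \<alpha> * (1 - \<gamma>) \<le> s * \<gamma>"
    by (rule reduce[OF _ \<alpha>_def \<gamma>_def])
      (use card_nbhd_ge[OF k d A A0 R(1)] in \<open>simp add: N_def\<close>)
  have "4 * s\<^sup>2 * (1 - \<gamma>) \<le> 4 * \<alpha> * (1 - \<gamma>)"
    using \<open>\<alpha> \<ge> s\<^sup>2\<close> \<gamma>1 by (intro mult_right_mono) auto
  then have "s * (4 * s * (1 - \<gamma>)) \<le> s * \<gamma>"
    using 1 by (simp add: power2_eq_square mult_ac)
  then have 2: "4 * s * (1 - \<gamma>) \<le> \<gamma>"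
    using s by (simp only: mult_le_cancel_left_pos)
  have "0 < \<gamma>"
  proof (rule ccontr)
    assume "\<not> 0 < \<gamma>"
    then have "\<gamma> \<le> 0" by simp
    then have "s * 4 \<le> 4 * s * (1 - \<gamma>)" using s by (simp add: mult_le_0_iff algebra_simps)
    then show False using 2 s \<open>\<gamma> \<le> 0\<close> by linarith
  qed
  then have "nbhd k d R A \<noteq> {}"
    by (auto simp: \<gamma>_def)
  then have 3: "4 * \<gamma> * (1 - \<delta>) \<le> s * \<delta>"
    by (intro reduce[OF _ \<gamma>_def \<delta>_def])
      (use card_nbhd_ge[OF k d nbhd_subset _ R(1)] in \<open>simp add: N_def\<close>)
  \<comment> \<open>The two steps now contradict each other. A final density of at most
    \<open>1 / 2\<close> keeps \<open>\<gamma>\<close> below \<open>s / 4\<close>, hence below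
    \<open>1 / 4\<close>, whereas the first step then gives
    \<open>1 - \<gamma> \<le> 1 / 16\<close>.\<close>
  have "4 * \<gamma> * (1 / 2) \<le> 4 * \<gamma> * (1 - \<delta>)"
    using \<open>\<delta> \<le> 1 / 2\<close> \<open>0 < \<gamma>\<close> by (intro mult_left_mono) auto
  moreover have "s * \<delta> \<le> s * (1 / 2)"
    using \<open>\<delta> \<le> 1 / 2\<close> s by (intro mult_left_mono) auto
  ultimately have "4 * \<gamma> \<le> s"
    using 3 by linarith
  moreover have "s * (16 * (1 - \<gamma>)) = 4 * (4 * s * (1 - \<gamma>))"
    by simp
  ultimately have "s * (16 * (1 - \<gamma>)) \<le> s * 1"
    using 2 by linarith
  then have "16 * (1 - \<gamma>) \<le> 1"
    using s(1) by (simp only: mult_le_cancel_left_pos)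
  moreover have "\<gamma> \<le> 1 / 4"
    using \<open>4 * \<gamma> \<le> s\<close> \<open>s \<le> 1\<close> by simp
  ultimately show False
    by simp
qed

lemma sqdist_four_steps:
  "sqdist k d a e \<le> 4 * (sqdist k d a b + sqdist k d b m + sqdist k d m c + sqdist k d c e)"
proof -
  have "(x + y + z + u)\<^sup>2 \<le> 4 * (x\<^sup>2 + y\<^sup>2 + z\<^sup>2 + u\<^sup>2)" for x y z u :: real
  proof -
    have "0 \<le> (x - y)\<^sup>2 + (x - z)\<^sup>2 + (x - u)\<^sup>2 + (y - z)\<^sup>2 + (y - u)\<^sup>2 + (z - u)\<^sup>2"
      by simp
    then show ?thesis
      by (simp add: power2_eq_square algebra_simps)
  qed
  from this[of "real (digit k j a) - real (digit k j b)" "real (digit k j b) - real (digit k j m)"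
      "real (digit k j m) - real (digit k j c)" "real (digit k j c) - real (digit k j e)" for j]
  show ?thesis
    unfolding sqdist_def sum.distrib[symmetric] sum_distrib_left by (intro sum_mono) simp
qed

text \<open>Two sets of more than half the points meet, so the double neighbourhoods of
  \<open>A\<close> and \<open>B\<close> share a point \<open>m\<close>, and \<open>a\<close>,
  \<open>a'\<close>, \<open>m\<close>, \<open>b'\<close>, \<open>b\<close> is a chain of four short
  steps. With \<open>Q = k^2 / sqrt p\<close> each step costs at most
  \<open>d + 2 * R^2 \<le> 17 * Q\<close>, as \<open>d \<le> k^2 \<le> Q\<close>; four steps and the
  factor 4 for squaring a sum of four terms give 272.\<close>

lemma close_pair:
  assumes k: "0 < k" and d: "0 < d" "d \<le> k\<^sup>2" and p: "0 < p"
    and A: "A \<subseteq> {..<k ^ d}" "p * real (k ^ d) \<le> real (card A)"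
    and B: "B \<subseteq> {..<k ^ d}" "p * real (k ^ d) \<le> real (card B)"
  shows "\<exists>a\<in>A. \<exists>b\<in>B. sqdist k d a b \<le> 272 * (real k)\<^sup>2 / sqrt p"
proof -
  define R where "R = sqrt (8 * (real k)\<^sup>2 / sqrt p)"
  have R2: "R\<^sup>2 = 8 * (real k)\<^sup>2 / sqrt p"
    using p by (simp add: R_def)
  have R: "0 < R"
    using p k by (simp add: R_def)
  define \<rho> where "\<rho> = (sqrt d + R)\<^sup>2"
  define Q where "Q = (real k)\<^sup>2 / sqrt p"
  let ?A = "nbhd k d R (nbhd k d R A)" and ?B = "nbhd k d R (nbhd k d R B)"
  have cards: "real (k ^ d) < 2 * real (card ?A)" "real (k ^ d) < 2 * real (card ?B)"
    using nbhd_nbhd_more_than_half[OF k d(1) A(1) p A(2) R R2]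
      nbhd_nbhd_more_than_half[OF k d(1) B(1) p B(2) R R2] by simp_all
  have "?A \<inter> ?B \<noteq> {}"
  proof
    assume "?A \<inter> ?B = {}"
    then have "card ?A + card ?B = card (?A \<union> ?B)"
      by (intro card_Un_disjoint[symmetric] finite_subset[OF nbhd_subset]) auto
    also have "\<dots> \<le> card {..<k ^ d}"
      by (intro card_mono) (use nbhd_subset[of k d R] in auto)
    finally have "real (card ?A) + real (card ?B) \<le> real (k ^ d)"
      by (simp only: card_lessThan flip: of_nat_add of_nat_le_iff[where 'a = real])
    then show False using cards by linarith
  qed
  then obtain a b m a' b' where *: "a \<in> A" "b \<in> B"
    "sqdist k d a a' + d < (sqrt d + R)\<^sup>2" "sqdist k d a' m + d < (sqrt d + R)\<^sup>2"
    "sqdist k d b b' + d < (sqrt d + R)\<^sup>2" "sqdist k d b' m + d < (sqrt d + R)\<^sup>2"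
    unfolding nbhd_def by blast
  have "card A \<le> k ^ d"
    using card_mono[OF _ A(1)] by simp
  then have "p * real (k ^ d) \<le> 1 * real (k ^ d)"
    using A(2) by (metis mult_1 of_nat_le_iff order_trans)
  then have "sqrt p \<le> 1"
    using k by simp
  have "(sqrt d + R)\<^sup>2 \<le> 2 * d + 2 * R\<^sup>2"
    using zero_le_power2[of "sqrt d - R"] by (simp add: power2_eq_square algebra_simps)
  moreover have "real d \<le> (real k)\<^sup>2 / sqrt p"
  proof -
    have "real d \<le> (real k)\<^sup>2"
      using d(2) by (metis of_nat_le_iff of_nat_power)
    also have "\<dots> = (real k)\<^sup>2 / 1" by simp
    also have "\<dots> \<le> (real k)\<^sup>2 / sqrt p"
      using \<open>sqrt p \<le> 1\<close> p by (intro divide_left_mono) auto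
    finally show ?thesis .
  qed
  ultimately have "(sqrt d + R)\<^sup>2 - d \<le> 17 * ((real k)\<^sup>2 / sqrt p)"
    unfolding R2 by simp
  moreover have "sqdist k d a b \<le> 4 * (sqdist k d a a' + sqdist k d a' m + sqdist k d m b' + sqdist k d b' b)"
    by (rule sqdist_four_steps)
  moreover have "sqdist k d a a' \<le> 17 * Q" "sqdist k d a' m \<le> 17 * Q"
      "sqdist k d m b' \<le> 17 * Q" "sqdist k d b' b \<le> 17 * Q"
    using *(3-6) sqdist_commute[of k d m b'] sqdist_commute[of k d b' b] calculation(1)
    unfolding \<rho>_def[symmetric] Q_def[symmetric] by simp_all
  ultimately have "sqdist k d a b \<le> 272 * ((real k)\<^sup>2 / sqrt p)"
    unfolding Q_def[symmetric] by simp
  then show ?thesis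
    using *(1,2) by auto
qed

section \<open>Laplacians and greedy matchings\<close>

lemma laplacian_carrier: "laplacian n H \<in> carrier_mat n n"
  unfolding laplacian_def adjacency_matrix_def by (rule minus_carrier_mat) simp

lemma laplacian_index:
  assumes "i < n" "j < n"
  shows "laplacian n H $$ (i, j) =
    (if i = j then real (size {#e \<in># H. i \<in> e#}) else 0) - real (count H {i, j})"
  using assms by (simp add: laplacian_def degree_matrix_def adjacency_matrix_def)

lemma laplacian_empty: "i < n \<Longrightarrow> j < n \<Longrightarrow> laplacian n {#} $$ (i, j) = 0"
  by (simp add: laplacian_index)

text \<open>One edge contributes a rank-one matrix, the outer square of the difference of two unit
  vectors. Symmetry, zero column sums and the quadratic form all follow from this by induction over
  the edges.\<close>

lemma laplacian_add_edge:
  assumes "i < n" "j < n" "u \<noteq> v"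
  shows "laplacian n (add_mset {u, v} H) $$ (i, j) = laplacian n H $$ (i, j) +
    (of_bool (i = u) - of_bool (i = v)) * (of_bool (j = u) - of_bool (j = v))"
proof -
  have "size {#e \<in># add_mset {u, v} H. i \<in> e#} = size {#e \<in># H. i \<in> e#} + of_bool (i = u \<or> i = v)"
    by simp
  moreover have "count (add_mset {u, v} H) {i, j}
      = count H {i, j} + of_bool (i = u \<and> j = v \<or> i = v \<and> j = u)"
    by (auto simp: doubleton_eq_iff)
  ultimately show ?thesis
    using assms(3) by (simp only: laplacian_index[OF assms(1,2)]) auto
qed

definition simple_edges :: "nat \<Rightarrow> multigraph \<Rightarrow> bool" where
  "simple_edges n H \<longleftrightarrow> (\<forall>e\<in>#H. \<exists>u v. u < n \<and> v < n \<and> u \<noteq> v \<and> e = {u, v})"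

text \<open>For an edge \<open>{u, v}\<close> with \<open>u \<noteq> v\<close> this is \<open>(x u - x v)\<^sup>2\<close>, written without choosing an
  orientation.\<close>

definition edge_energy :: "('v \<Rightarrow> real) \<Rightarrow> 'v set \<Rightarrow> real" where
  "edge_energy x e = 2 * (\<Sum>v\<in>e. (x v)\<^sup>2) - (\<Sum>v\<in>e. x v)\<^sup>2"

lemma edge_energy_doubleton: "u \<noteq> v \<Longrightarrow> edge_energy x {u, v} = (x u - x v)\<^sup>2"
  by (simp add: edge_energy_def power2_eq_square algebra_simps)

lemma laplacian_properties:
  assumes "simple_edges n H"
  shows laplacian_symmetric: "\<And>i j. i < n \<Longrightarrow> j < n \<Longrightarrow> laplacian n H $$ (i, j) = laplacian n H $$ (j, i)"
    and laplacian_column_sum: "\<And>j. j < n \<Longrightarrow> (\<Sum>i<n. laplacian n H $$ (i, j)) = 0"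
    and laplacian_quadratic_form:
      "(\<Sum>i<n. \<Sum>j<n. x i * laplacian n H $$ (i, j) * x j) = (\<Sum>e\<in>#H. edge_energy x e)"
proof -
  have "(\<forall>i<n. \<forall>j<n. laplacian n H $$ (i, j) = laplacian n H $$ (j, i)) \<and>
    (\<forall>j<n. (\<Sum>i<n. laplacian n H $$ (i, j)) = 0) \<and>
    (\<Sum>i<n. \<Sum>j<n. x i * laplacian n H $$ (i, j) * x j) = (\<Sum>e\<in>#H. edge_energy x e)"
    using assms
  proof (induction H)
    case empty
    then show ?case by (simp add: laplacian_empty)
  next
    case (add e H)
    then obtain u v where uv: "u < n" "v < n" "u \<noteq> v" and e: "e = {u, v}"
      by (auto simp: simple_edges_def)
    define \<epsilon> :: "nat \<Rightarrow> real" where "\<epsilon> i = of_bool (i = u) - of_bool (i = v)" for i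
    have entry: "laplacian n (add_mset e H) $$ (i, j) = laplacian n H $$ (i, j) + \<epsilon> i * \<epsilon> j"
      if "i < n" "j < n" for i j
      using laplacian_add_edge[OF that uv(3)] by (simp add: e \<epsilon>_def)
    have IH: "\<forall>i<n. \<forall>j<n. laplacian n H $$ (i, j) = laplacian n H $$ (j, i)"
      "\<forall>j<n. (\<Sum>i<n. laplacian n H $$ (i, j)) = 0"
      "(\<Sum>i<n. \<Sum>j<n. x i * laplacian n H $$ (i, j) * x j) = (\<Sum>e\<in>#H. edge_energy x e)"
      using add by (auto simp: simple_edges_def)
    have weighted: "(\<Sum>i<n. y i * \<epsilon> i) = y u - y v" for y :: "nat \<Rightarrow> real"
    proof -
      have "(\<Sum>i<n. y i * \<epsilon> i) = (\<Sum>i<n. (if i = u then y i else 0) - (if i = v then y i else 0))"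
        by (intro sum.cong) (auto simp: \<epsilon>_def)
      then show ?thesis
        using uv by (simp add: sum_subtractf)
    qed
    have "(\<Sum>i<n. \<epsilon> i) = 0"
      using weighted[of "\<lambda>_. 1"] by simp
    then have "\<forall>j<n. (\<Sum>i<n. laplacian n (add_mset e H) $$ (i, j)) = 0"
      using IH(2) by (simp add: entry sum.distrib flip: sum_distrib_right)
    moreover have "\<forall>i<n. \<forall>j<n. laplacian n (add_mset e H) $$ (i, j) = laplacian n (add_mset e H) $$ (j, i)"
      using IH(1) by (simp add: entry)
    moreover have "(\<Sum>i<n. \<Sum>j<n. x i * laplacian n (add_mset e H) $$ (i, j) * x j)
        = (\<Sum>i<n. \<Sum>j<n. x i * laplacian n H $$ (i, j) * x j) + (\<Sum>i<n. x i * \<epsilon> i) * (\<Sum>j<n. x j * \<epsilon> j)"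
      unfolding sum_product sum.distrib[symmetric]
      by (intro sum.cong refl) (simp add: entry algebra_simps)
    ultimately show ?case
      by (simp add: IH(3) weighted e edge_energy_doubleton[OF uv(3)] power2_eq_square)
  qed
  then show "\<And>i j. i < n \<Longrightarrow> j < n \<Longrightarrow> laplacian n H $$ (i, j) = laplacian n H $$ (j, i)"
    "\<And>j. j < n \<Longrightarrow> (\<Sum>i<n. laplacian n H $$ (i, j)) = 0"
    "(\<Sum>i<n. \<Sum>j<n. x i * laplacian n H $$ (i, j) * x j) = (\<Sum>e\<in>#H. edge_energy x e)"
    by blast+
qed

lemma lambda2_laplacian_le:
  assumes H: "simple_edges n H" and n: "0 < n"
    and pos: "0 < (\<Sum>i<n. (x i - (\<Sum>i<n. x i) / n)\<^sup>2)"
    and le: "(\<Sum>e\<in>#H. edge_energy x e) \<le> c * (\<Sum>i<n. (x i - (\<Sum>i<n. x i) / n)\<^sup>2)"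
    and c: "0 \<le> c"
  shows "lambda2 (laplacian n H) \<le> c"
proof -
  define y where "y i = x i - (\<Sum>i<n. x i) / n" for i
  have y0: "(\<Sum>i<n. y i) = 0"
    using n by (simp add: y_def sum_subtractf)
  have "\<exists>m<n. y m \<noteq> 0"
  proof (rule ccontr)
    assume "\<not> (\<exists>m<n. y m \<noteq> 0)"
    then have "(\<Sum>i<n. (y i)\<^sup>2) = 0" by simp
    then show False using pos by (simp add: y_def)
  qed
  then obtain m where m: "m < n" "y m \<noteq> 0" by blast
  have "edge_energy y e = edge_energy x e" if "e \<in># H" for e
    using H that by (auto simp: simple_edges_def y_def edge_energy_doubleton)
  then have "(\<Sum>e\<in>#H. edge_energy y e) = (\<Sum>e\<in>#H. edge_energy x e)"
    by (metis image_mset_cong)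
  then show ?thesis
    using le c
    by (intro lambda2_le_rayleigh[OF laplacian_carrier laplacian_symmetric[OF H] laplacian_column_sum[OF H] y0 m])
      (simp_all add: laplacian_quadratic_form[OF H] flip: y_def)
qed

text \<open>Removing a matched pair keeps the sides equally large, so the hypothesis on subsets
  applies again. The costs \<open>K / sqrt m\<close> for \<open>m\<close> from 1 to
  \<open>card S\<close> are compared with an integral: \<open>1 / sqrt (m + 1)\<close> is at most
  \<open>2 * (sqrt (m + 1) - sqrt m)\<close>.\<close>

lemma greedy_matching:
  fixes cost :: "'a \<Rightarrow> 'b \<Rightarrow> real"
  assumes "finite S" "finite T" "card S = card T" "0 \<le> K"
    and "\<And>S' T'. S' \<subseteq> S \<Longrightarrow> T' \<subseteq> T \<Longrightarrow> card S' = card T' \<Longrightarrow> S' \<noteq> {} \<Longrightarrow>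
      \<exists>a\<in>S'. \<exists>b\<in>T'. cost a b \<le> K / sqrt (card S')"
  shows "\<exists>\<pi>. bij_betw \<pi> S T \<and> (\<Sum>a\<in>S. cost a (\<pi> a)) \<le> 2 * K * sqrt (card S)"
  using assms
proof (induction "card S" arbitrary: S T)
  case 0
  then show ?case by (auto simp: bij_betw_def)
next
  case (Suc m)
  have "S \<noteq> {}" using Suc.hyps(2) by auto
  with Suc.prems obtain a b where ab: "a \<in> S" "b \<in> T" "cost a b \<le> K / sqrt (card S)"
    by blast
  have "\<exists>\<pi>. bij_betw \<pi> (S - {a}) (T - {b}) \<and> (\<Sum>x\<in>S - {a}. cost x (\<pi> x)) \<le> 2 * K * sqrt (card (S - {a}))"
  proof (rule Suc.hyps(1))
    show "m = card (S - {a})" "card (S - {a}) = card (T - {b})"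
      using Suc ab by simp_all
    show "\<exists>a\<in>S'. \<exists>b\<in>T'. cost a b \<le> K / sqrt (card S')"
      if "S' \<subseteq> S - {a}" "T' \<subseteq> T - {b}" "card S' = card T'" "S' \<noteq> {}" for S' T'
      using that by (intro Suc.prems(5)) auto
  qed (use Suc.prems in auto)
  then obtain \<pi> where \<pi>: "bij_betw \<pi> (S - {a}) (T - {b})"
    "(\<Sum>x\<in>S - {a}. cost x (\<pi> x)) \<le> 2 * K * sqrt (card (S - {a}))" by blast
  have cards: "card S = Suc m" "card (S - {a}) = m"
    using Suc ab by simp_all
  define \<pi>' where "\<pi>' = \<pi>(a := b)"
  have "bij_betw \<pi>' (S - {a}) (T - {b})"
    using \<pi>(1) by (subst bij_betw_cong[of _ _ \<pi>]) (auto simp: \<pi>'_def)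
  then have "bij_betw \<pi>' (insert a (S - {a})) (insert b (T - {b}))"
    using notIn_Un_bij_betw[of a "S - {a}" \<pi>' "T - {b}"] by (simp add: \<pi>'_def)
  then have "bij_betw \<pi>' S T"
    using ab by (simp add: insert_absorb)
  moreover have "(\<Sum>x\<in>S. cost x (\<pi>' x)) \<le> 2 * K * sqrt (card S)"
  proof -
    have "(\<Sum>x\<in>S. cost x (\<pi>' x)) = cost a b + (\<Sum>x\<in>S - {a}. cost x (\<pi>' x))"
      using Suc.prems(1) ab by (subst sum.remove[of _ a]) (auto simp: \<pi>'_def)
    also have "(\<Sum>x\<in>S - {a}. cost x (\<pi>' x)) = (\<Sum>x\<in>S - {a}. cost x (\<pi> x))"
      by (intro sum.cong) (auto simp: \<pi>'_def)
    finally have "(\<Sum>x\<in>S. cost x (\<pi>' x)) \<le> K / sqrt (Suc m) + 2 * K * sqrt m"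
      using ab(3) \<pi>(2) cards by simp
    also have "\<dots> \<le> 2 * K * sqrt (Suc m)"
    proof -
      define s where "s = sqrt (Suc m)"
      define t where "t = sqrt m"
      have s: "0 < s" "t \<le> s" "0 \<le> t" "s * s = t * t + 1"
        by (simp_all add: s_def t_def)
      have "0 \<le> (s - t)\<^sup>2" by simp
      then have "1 + 2 * t * s \<le> 2 * s * s"
        using s(4) by (simp add: power2_eq_square algebra_simps)
      then have "1 / s + 2 * t \<le> 2 * s"
        using s(1) by (simp add: field_simps)
      then have "K * (1 / s + 2 * t) \<le> K * (2 * s)"
        using Suc.prems(4) by (intro mult_left_mono)
      then show ?thesis
        by (simp add: s_def t_def algebra_simps)
    qed
    finally show ?thesis unfolding cards .
  qed
  ultimately show ?case by blast
qed

text \<open>Vertex \<open>i\<close> is placed at grid point \<open>i mod N\<close>. A grid point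
  receives at most \<open>n div N + 1\<close> vertices, which is at most \<open>2 * n / N\<close>,
  so passing to the grid at most halves the density.\<close>

lemma card_image_mod_ge:
  fixes N n :: nat
  assumes "0 < N" "N \<le> n" "V \<subseteq> {..<n}"
  shows "real (card V) * N \<le> 2 * n * real (card ((\<lambda>i. i mod N) ` V))"
proof -
  let ?I = "(\<lambda>i. i mod N) ` V"
  have fin: "finite V" using assms(3) finite_subset by blast
  have "card V \<le> card (?I \<times> {..n div N})"
  proof (rule card_inj_on_le[of "\<lambda>i. (i mod N, i div N)"])
    show "inj_on (\<lambda>i. (i mod N, i div N)) V"
      by (metis (mono_tags, lifting) div_mult_mod_eq inj_onI prod.inject)
    show "(\<lambda>i. (i mod N, i div N)) ` V \<subseteq> ?I \<times> {..n div N}"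
      using assms(3) by (auto intro!: div_le_mono)
  qed (use fin in auto)
  then have "card V * N \<le> card ?I * (n div N * N + N)"
    using mult_le_mono1[of "card V" "card (?I \<times> {..n div N})" N]
    by (simp add: card_cartesian_product algebra_simps)
  also have "n div N * N + N \<le> 2 * n"
    using assms(2) div_times_less_eq_dividend[of n N] by linarith
  finally have "card V * N \<le> 2 * n * card ?I"
    by (simp add: mult_ac)
  then show ?thesis
    by (metis of_nat_le_iff of_nat_mult of_nat_numeral)
qed

lemma cheap_matching:
  assumes k: "0 < k" and d: "0 < d" "d \<le> k\<^sup>2" and kn: "k ^ d \<le> n"
    and n: "even n" and S: "bisection n S"
  shows "\<exists>\<pi>. bij_betw \<pi> S ({..<n} - S) \<and>
    (\<Sum>a\<in>S. sqdist k d a (\<pi> a)) \<le> 544 * (real k)\<^sup>2 * n"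
proof -
  \<comment> \<open>272 comes from \<open>close_pair\<close>; \<open>sqrt (2 * n)\<close> converts
    the density \<open>card S' / (2 * n)\<close> guaranteed on the grid back into
    \<open>card S'\<close>.\<close>
  define K where "K = 272 * (real k)\<^sup>2 * sqrt (2 * n)"
  have sub: "S \<subseteq> {..<n}" and cS: "card S = n div 2"
    using S by (auto simp: bisection_def)
  have fin: "finite S" using sub finite_subset by blast
  have N: "0 < k ^ d" using k by simp
  have n0: "0 < n" using N kn by linarith
  have "\<exists>\<pi>. bij_betw \<pi> S ({..<n} - S) \<and> (\<Sum>a\<in>S. sqdist k d a (\<pi> a)) \<le> 2 * K * sqrt (card S)"
  proof (rule greedy_matching)
    show "card S = card ({..<n} - S)"
      using card_Diff_subset[OF fin sub] cS n by (auto elim: evenE)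
    fix S' T' assume S': "S' \<subseteq> S" and T': "T' \<subseteq> {..<n} - S" and eq: "card S' = card T'" and ne: "S' \<noteq> {}"
    define p where "p = card S' / (2 * real n)"
    have "0 < card S'"
      using ne finite_subset[OF S' fin] by (simp add: card_gt_0_iff)
    then have p: "0 < p" using n0 by (simp add: p_def)
    have large: "p * real (k ^ d) \<le> real (card ((\<lambda>i. i mod k ^ d) ` V))"
      if "V \<subseteq> {..<n}" "card V = card S'" for V
    proof -
      have "real (card S') * real (k ^ d) \<le> (2 * real n) * real (card ((\<lambda>i. i mod k ^ d) ` V))"
        using card_image_mod_ge[OF N kn that(1)] that(2) by (simp only: of_nat_mult of_nat_numeral)
      then show ?thesis
        using n0 by (simp add: p_def divide_le_eq mult.commute)
    qed
    \<comment> \<open>The images of \<open>S'\<close> and \<open>T'\<close> on the grid may overlap,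
      and then a pair at distance 0 is available; \<open>close_pair\<close> asks only for
      density.\<close>
    have "\<exists>a\<in>(\<lambda>i. i mod k ^ d) ` S'. \<exists>b\<in>(\<lambda>i. i mod k ^ d) ` T'.
        sqdist k d a b \<le> 272 * (real k)\<^sup>2 / sqrt p"
      using S' T' sub eq N by (intro close_pair k d p large) auto
    moreover have "272 * (real k)\<^sup>2 / sqrt p = K / sqrt (card S')"
      using n0 by (simp add: K_def p_def real_sqrt_divide)
    ultimately show "\<exists>a\<in>S'. \<exists>b\<in>T'. sqdist k d a b \<le> K / sqrt (card S')"
      by (auto simp: sqdist_mod[OF k])
  qed (use fin in \<open>auto simp: K_def\<close>)
  moreover have "2 * K * sqrt (card S) = 544 * (real k)\<^sup>2 * n"
  proof -
    have "real (card S) = real n / 2"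
      using cS n by auto
    then have "2 * real n * real (card S) = (real n)\<^sup>2"
      by (simp add: power2_eq_square)
    then have "sqrt (2 * n) * sqrt (card S) = n"
      unfolding real_sqrt_mult[symmetric] by simp
    then show ?thesis
      by (simp add: K_def mult.assoc)
  qed
  ultimately show ?thesis by auto
qed

lemma perfect_matching_across_bij:
  assumes S: "S \<subseteq> {..<n}" and \<pi>: "bij_betw \<pi> S ({..<n} - S)"
  shows "perfect_matching_across n S ((\<lambda>a. {a, \<pi> a}) ` S)"
proof -
  have out: "\<pi> a \<notin> S \<and> \<pi> a < n" if "a \<in> S" for a
    using \<pi> that by (auto simp: bij_betw_def)
  have inj: "a = b" if "\<pi> a = \<pi> b" "a \<in> S" "b \<in> S" for a b
    using \<pi> that by (auto simp: bij_betw_def inj_on_def)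
  have "\<exists>!e. e \<in> (\<lambda>a. {a, \<pi> a}) ` S \<and> v \<in> e" if v: "v < n" for v
  proof (cases "v \<in> S")
    case True
    then show ?thesis
      using out by (intro ex1I[of _ "{v, \<pi> v}"]) auto
  next
    case False
    then obtain a where "a \<in> S" "v = \<pi> a"
      using v \<pi> by (auto simp: bij_betw_def)
    then show ?thesis
      using out inj by (intro ex1I[of _ "{a, \<pi> a}"]) auto
  qed
  then show ?thesis
    using out unfolding perfect_matching_across_def by blast
qed

lemma sum_edge_energy_matching:
  assumes "bij_betw \<pi> S ({..<n} - S)"
  shows "(\<Sum>e\<in>(\<lambda>a. {a, \<pi> a}) ` S. \<Sum>j<d. edge_energy (\<lambda>v. real (digit k j v)) e)
    = (\<Sum>a\<in>S. sqdist k d a (\<pi> a))"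
proof -
  have out: "\<pi> a \<notin> S" if "a \<in> S" for a
    using assms that by (auto simp: bij_betw_def)
  then have "inj_on (\<lambda>a. {a, \<pi> a}) S"
    by (auto simp: inj_on_def doubleton_eq_iff)
  then show ?thesis
    unfolding sqdist_def using out
    by (subst sum.reindex) (auto intro!: sum.cong edge_energy_doubleton, metis)
qed

section \<open>Variance of a coordinate\<close>

lemma sum_centred_squares:
  fixes c :: real
  shows "12 * (\<Sum>s<k. (real s - c)\<^sup>2) = k * ((real k)\<^sup>2 - 1) + 3 * k * (2 * c - (real k - 1))\<^sup>2"
proof (induction k)
  case (Suc k)
  define x where "x = real k"
  have "12 * (\<Sum>s<Suc k. (real s - c)\<^sup>2)
      = x * (x\<^sup>2 - 1) + 3 * x * (2 * c - (x - 1))\<^sup>2 + 12 * (x - c)\<^sup>2"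
    using Suc by (simp add: x_def)
  also have "\<dots> = (x + 1) * ((x + 1)\<^sup>2 - 1) + 3 * (x + 1) * (2 * c - (x + 1 - 1))\<^sup>2"
    by (simp add: power2_eq_square algebra_simps)
  finally show ?case
    by (simp add: x_def add.commute)
qed simp

text \<open>The centre \<open>c\<close> is arbitrary, so the mean of the digits over the vertices is
  never computed. Only complete periods of length \<open>k ^ Suc j\<close> are counted; they cover
  more than half of the vertices, and within a period each digit value occurs \<open>k ^ j\<close>
  times. The factor \<open>1 / 32\<close> is that half times \<open>1 / 16\<close>, a lower bound
  for \<open>(k^2 - 1) / (12 * k^2)\<close> when \<open>k\<close> is at least 2.\<close>

lemma digit_variance_ge:
  assumes k: "2 \<le> k" and j: "j < d" and kn: "k ^ d \<le> n"
  shows "real n * (real k)\<^sup>2 / 32 \<le> (\<Sum>i<n. (real (digit k j i) - c)\<^sup>2)"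
proof -
  define N where "N = k ^ Suc j"
  define q where "q = n div N"
  have N: "0 < N" using k by (simp add: N_def)
  have "N \<le> k ^ d"
    unfolding N_def using k j by (intro power_increasing) auto
  then have "N \<le> n" using kn by simp
  then have "1 \<le> q" using N by (simp add: q_def div_greater_zero_iff Suc_le_eq)
  have "n < q * N + N"
    unfolding q_def using N by (metis add.commute div_mult_mod_eq mod_less_divisor nat_add_left_cancel_less)
  also have "\<dots> \<le> 2 * (q * N)" using \<open>1 \<le> q\<close> by simp
  finally have "real n \<le> 2 * (real q * real N)"
    by (metis less_imp_le of_nat_le_iff of_nat_mult of_nat_numeral)
  have "k * ((real k)\<^sup>2 - 1) \<le> 12 * (\<Sum>s<k. (real s - c)\<^sup>2)"
    unfolding sum_centred_squares by simp
  moreover have "(real k)\<^sup>2 - 1 \<ge> 3 / 4 * (real k)\<^sup>2"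
    using power_mono[of 2 "real k" 2] k by simp
  then have "real k * (3 / 4 * (real k)\<^sup>2) \<le> real k * ((real k)\<^sup>2 - 1)"
    by (intro mult_left_mono) auto
  ultimately have line: "real k * (real k)\<^sup>2 / 16 \<le> (\<Sum>s<k. (real s - c)\<^sup>2)"
    by simp
  have "real n * (real k)\<^sup>2 / 32 \<le> 2 * (real q * real N) * (real k)\<^sup>2 / 32"
    using \<open>real n \<le> 2 * (real q * real N)\<close> by (intro divide_right_mono mult_right_mono) auto
  also have "\<dots> = real q * (real (k ^ j) * (real k * (real k)\<^sup>2 / 16))"
    by (simp add: N_def)
  also have "\<dots> \<le> real q * (real (k ^ j) * (\<Sum>s<k. (real s - c)\<^sup>2))"
    by (intro mult_left_mono line) auto
  also have "\<dots> = (\<Sum>m<q. \<Sum>r<N. (real (digit k j (m * N + r)) - c)\<^sup>2)"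
  proof -
    have "(\<Sum>r<N. (real (digit k j (m * N + r)) - c)\<^sup>2) = real (k ^ j) * (\<Sum>s<k. (real s - c)\<^sup>2)" for m
    proof -
      have "(\<Sum>r<N. (real (digit k j (m * N + r)) - c)\<^sup>2) = (\<Sum>r<k * k ^ j. (real (digit k j r) - c)\<^sup>2)"
        unfolding N_def using k by (intro sum.cong) (auto simp: digit_add_low simp del: power_Suc, auto)
      also have "\<dots> = (\<Sum>s<k. \<Sum>t<k ^ j. (real s - c)\<^sup>2)"
        unfolding sum_lessThan_mult by (intro sum.cong refl) (auto simp: digit_add_top)
      finally show ?thesis by (simp add: sum_distrib_left)
    qed
    then show ?thesis by simp
  qed
  also have "\<dots> = (\<Sum>i<q * N. (real (digit k j i) - c)\<^sup>2)"
    by (rule sum_lessThan_mult[symmetric])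
  also have "\<dots> \<le> (\<Sum>i<n. (real (digit k j i) - c)\<^sup>2)"
    by (intro sum_mono2) (auto simp: q_def intro: less_le_trans[OF _ div_times_less_eq_dividend])
  finally show ?thesis .
qed

section \<open>The history-independent strategy\<close>

lemma matching_sum_snoc: "matching_sum (h @ [(S, M)]) = matching_sum h + mset_set M"
  by (simp add: matching_sum_def)

text \<open>Some coordinate carries at most a \<open>1 / d\<close> share of the total energy, while
  its variance is at least \<open>n * k^2 / 32\<close>. So \<open>n\<close> and \<open>k\<close>
  cancel, leaving \<open>544 * 32 = 17408\<close>.\<close>

lemma lambda2_le_of_digit_energies:
  assumes k: "2 \<le> k" and d: "0 < d" and kn: "k ^ d \<le> n" and H: "simple_edges n H"
    and le: "(\<Sum>e\<in>#H. \<Sum>j<d. edge_energy (\<lambda>v. real (digit k j v)) e) \<le> 544 * (real k)\<^sup>2 * n * t"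
    and t: "0 \<le> t"
  shows "lambda2 (laplacian n H) \<le> 17408 * t / d"
proof -
  have n: "0 < n" using kn k by (metis gr0I le_0_eq power_not_zero not_numeral_le_zero)
  define E where "E j = (\<Sum>e\<in>#H. edge_energy (\<lambda>v. real (digit k j v)) e)" for j
  define b where "b = 544 * (real k)\<^sup>2 * n * t / d"
  have "(\<Sum>j<d. E j) = (\<Sum>e\<in>#H. \<Sum>j<d. edge_energy (\<lambda>v. real (digit k j v)) e)"
    unfolding E_def by (induction H) (simp_all add: sum.distrib)
  then have "(\<Sum>j<d. E j) \<le> (\<Sum>j<d. b)"
    using le d by (simp add: b_def)
  then obtain j where j: "j < d" "E j \<le> b"
    using sum_strict_mono[of "{..<d}" "\<lambda>_. b" E] d by (force simp: not_le)
  define V where "V = (\<Sum>i<n. (real (digit k j i) - (\<Sum>i<n. real (digit k j i)) / n)\<^sup>2)"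
  have V: "real n * (real k)\<^sup>2 / 32 \<le> V"
    unfolding V_def by (rule digit_variance_ge[OF k j(1) kn])
  have "0 < real n * (real k)\<^sup>2 / 32"
    using n k by simp
  then have "0 < V"
    using V by linarith
  have "b = 17408 * t / d * (real n * (real k)\<^sup>2 / 32)"
    by (simp add: b_def)
  also have "\<dots> \<le> 17408 * t / d * V"
    using V t by (intro mult_left_mono) auto
  finally have "E j \<le> 17408 * t / d * V"
    using j by simp
  then show ?thesis
    using \<open>0 < V\<close> t unfolding V_def E_def by (intro lambda2_laplacian_le[OF H n]) auto
qed

text \<open>The cost bound for a matching holds for every bisection and the energies of the rounds
  add up, so the total after \<open>t\<close> rounds is linear in \<open>t\<close> however the cuts
  depend on the past. The coordinate used as test vector may change with \<open>t\<close> and with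
  the cut player; only the analysis refers to it.\<close>

lemma oblivious_strategy:
  assumes k: "2 \<le> k" and d: "0 < d" "d \<le> k\<^sup>2" and kn: "k ^ d \<le> n" and n: "even n"
  shows "\<exists>\<mu>. is_matching_strategy n \<mu> \<and> (\<forall>\<kappa>. is_cut_strategy n \<kappa> \<longrightarrow>
    (\<forall>t. lambda2 (laplacian n (matching_sum (play \<mu> \<kappa> t))) \<le> 17408 * real t / d))"
proof -
  have "\<forall>S. \<exists>\<pi>. bisection n S \<longrightarrow> bij_betw \<pi> S ({..<n} - S) \<and>
      (\<Sum>a\<in>S. sqdist k d a (\<pi> a)) \<le> 544 * (real k)\<^sup>2 * n"
    using cheap_matching[OF _ d kn n] k by auto
  then obtain \<pi> where \<pi>: "\<And>S. bisection n S \<Longrightarrow> bij_betw (\<pi> S) S ({..<n} - S)"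
    and cost: "\<And>S. bisection n S \<Longrightarrow> (\<Sum>a\<in>S. sqdist k d a (\<pi> S a)) \<le> 544 * (real k)\<^sup>2 * n"
    by metis
  define \<mu> :: matching_strategy where "\<mu> h S = (\<lambda>a. {a, \<pi> S a}) ` S" for h S
  have "is_matching_strategy n \<mu>"
    unfolding is_matching_strategy_def \<mu>_def
    using \<pi> by (auto simp: bisection_def intro!: perfect_matching_across_bij)
  moreover have "lambda2 (laplacian n (matching_sum (play \<mu> \<kappa> t))) \<le> 17408 * real t / d"
    if \<kappa>: "is_cut_strategy n \<kappa>" for \<kappa> t
  proof -
    let ?W = "\<lambda>e. \<Sum>j<d. edge_energy (\<lambda>v. real (digit k j v)) e"
    have "simple_edges n (matching_sum (play \<mu> \<kappa> t)) \<and>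
      (\<Sum>e\<in>#matching_sum (play \<mu> \<kappa> t). ?W e) \<le> 544 * (real k)\<^sup>2 * n * real t"
    proof (induction t)
      case 0
      then show ?case by (simp add: matching_sum_def simple_edges_def)
    next
      case (Suc t)
      define S where "S = \<kappa> (play \<mu> \<kappa> t)"
      define M where "M = (\<lambda>a. {a, \<pi> S a}) ` S"
      have S: "bisection n S"
        using \<kappa> by (simp add: is_cut_strategy_def S_def)
      then have sub: "S \<subseteq> {..<n}" by (simp add: bisection_def)
      then have fin: "finite M" unfolding M_def using finite_subset by blast
      have sum: "matching_sum (play \<mu> \<kappa> (Suc t)) = matching_sum (play \<mu> \<kappa> t) + mset_set M"
        by (simp add: Let_def matching_sum_snoc \<mu>_def M_def S_def)
      have "\<exists>u v. u < n \<and> v < n \<and> u \<noteq> v \<and> e = {u, v}" if e: "e \<in> M" for e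
      proof -
        obtain a where a: "a \<in> S" "e = {a, \<pi> S a}"
          using e unfolding M_def by blast
        then have "\<pi> S a \<in> {..<n} - S"
          using \<pi>[OF S] by (auto simp: bij_betw_def)
        then show ?thesis
          using a sub by (intro exI[of _ a] exI[of _ "\<pi> S a"]) auto
      qed
      then have "simple_edges n (matching_sum (play \<mu> \<kappa> (Suc t)))"
        using Suc.IH fin unfolding sum simple_edges_def by auto
      moreover have "(\<Sum>e\<in>#mset_set M. ?W e) \<le> 544 * (real k)\<^sup>2 * n"
        using cost[OF S] sum_edge_energy_matching[OF \<pi>[OF S], of k d]
        unfolding M_def[symmetric] sum_unfold_sum_mset[symmetric] by simp
      ultimately show ?case
        using Suc.IH unfolding sum by (simp add: algebra_simps)
    qed
    then show ?thesis
      by (intro lambda2_le_of_digit_energies[OF k d(1) kn]) auto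
  qed
  ultimately show ?thesis by blast
qed

section \<open>The choice of the dimension\<close>

lemma one_less_ln_4: "1 < ln (4 :: real)"
proof -
  have "exp 1 < (4 :: real)" using exp_le by simp
  then show ?thesis by (metis ln_exp ln_less_cancel_iff exp_gt_zero zero_less_numeral)
qed

lemma ln_ln_4_pos: "0 < ln (ln (4 :: real))"
  using one_less_ln_4 by simp

text \<open>Take \<open>d\<close> maximal, so that \<open>n < (d + 1) ^ (d + 1)\<close>. If
  \<open>d\<close> is at least 3, then \<open>ln d \<ge> 1\<close> gives
  \<open>d \<le> ln n\<close>, hence \<open>ln d \<le> ln (ln n)\<close>; with
  \<open>d + 1 \<le> d^2\<close> this makes \<open>ln n\<close> at most
  \<open>4 * d * ln (ln n)\<close>. The case \<open>d = 2\<close> means \<open>n < 27\<close>, where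
  \<open>ln (ln n)\<close> is only known to be at least \<open>ln (ln 4)\<close>; this is the second
  summand of the constant.\<close>

lemma dimension_exists:
  fixes n :: nat
  assumes n: "4 \<le> n"
  shows "\<exists>d\<ge>2. d ^ d \<le> n \<and> 1 / real d \<le> (4 + ln 27 / ln (ln 4)) * (ln (ln n) / ln n)"
proof -
  \<comment> \<open>The floor 3 on \<open>e\<close> guarantees \<open>d = e - 1 \<ge> 2\<close>.
    When the floor itself is attained, \<open>d ^ d \<le> n\<close> comes from
    \<open>4 \<le> n\<close> instead of minimality.\<close>
  define P where "P e \<longleftrightarrow> 3 \<le> e \<and> n < e ^ e" for e :: nat
  have "n + 3 \<le> (n + 3) ^ (n + 3)"
    by (rule self_le_power) auto
  then have "n < (n + 3) ^ (n + 3)" by linarith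
  then have "P (n + 3)" unfolding P_def by simp
  define e where "e = (LEAST e. P e)"
  have Pe: "P e" unfolding e_def by (rule LeastI[of P, OF \<open>P (n + 3)\<close>])
  define d where "d = e - 1"
  have e: "e = Suc d" and d2: "2 \<le> d"
    using Pe by (auto simp: d_def P_def)
  have "\<not> P d" unfolding e_def[symmetric] using not_less_Least[of d P] e by (simp add: e_def)
  then have dn: "d ^ d \<le> n"
    using n d2 by (cases "d = 2") (auto simp: P_def)
  have ln4: "ln (ln 4) \<le> ln (ln (real n))" and ln0: "1 < ln (real n)"
  proof -
    have "1 < ln (4 :: real)" by (rule one_less_ln_4)
    moreover have "ln 4 \<le> ln (real n)" using n by simp
    ultimately show "ln (ln 4) \<le> ln (ln (real n))" "1 < ln (real n)" by simp_all
  qed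
  have L: "0 < ln (ln (real n))" using ln0 by simp
  define B where "B = ln 27 / ln (ln (4 :: real))"
  have B0: "0 \<le> B" using ln_ln_4_pos by (simp add: B_def)
  define C where "C = 4 + B"
  have "ln n \<le> C * real d * ln (ln n)"
  proof (cases "d = 2")
    case True
    then have "n < 27" using Pe by (simp add: P_def e)
    then have "ln n \<le> ln 27" using n by simp
    also have "\<dots> = B * ln (ln 4)"
      using ln_ln_4_pos by (simp add: B_def)
    also have "\<dots> \<le> C * real d * ln (ln n)"
      using B0 ln_ln_4_pos by (intro mult_mono ln4) (simp_all add: C_def True)
    finally show ?thesis .
  next
    case False
    then have d3: "3 \<le> d" using d2 by simp
    have "exp 1 \<le> real d" using exp_le d3 by (metis of_nat_le_iff of_nat_numeral order_trans)
    then have "1 \<le> ln (real d)" using d3 by (subst ln_ge_iff) auto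
    then have "real d * 1 \<le> real d * ln (real d)" by (intro mult_left_mono) auto
    also have "\<dots> = ln (real (d ^ d))" using d3 by (simp add: ln_realpow)
    also have "\<dots> \<le> ln (real n)" using dn d3 n by (subst ln_le_cancel_iff) (auto simp del: of_nat_power)
    finally have "real d \<le> ln n" by simp
    then have lnd: "ln (real d) \<le> ln (ln n)" using d3 by simp
    have "real n \<le> real (Suc d ^ Suc d)" using Pe by (simp add: P_def e del: of_nat_power power_Suc)
    then have "ln n \<le> ln (real (Suc d ^ Suc d))" using n by (subst ln_le_cancel_iff) (auto simp del: of_nat_power power_Suc)
    also have "\<dots> = real (Suc d) * ln (real (Suc d))" by (simp add: ln_realpow del: power_Suc)
    also have "\<dots> \<le> (2 * real d) * (2 * ln (ln n))"
    proof (intro mult_mono)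
      have "d * 3 \<le> d * d" using d3 by (intro mult_left_mono) auto
      then have "Suc d \<le> d ^ 2" using d3 unfolding power2_eq_square by linarith
      then have "ln (real (Suc d)) \<le> ln (real d ^ 2)"
        using d3 by (subst ln_le_cancel_iff) (auto simp flip: of_nat_power)
      then show "ln (real (Suc d)) \<le> 2 * ln (ln n)"
        using lnd d3 by (simp add: ln_realpow)
    qed (use d3 L in auto)
    also have "\<dots> = 4 * real d * ln (ln n)" by simp
    also have "\<dots> \<le> C * real d * ln (ln n)"
      using L B0 by (intro mult_right_mono) (auto simp: C_def)
    finally show ?thesis .
  qed
  then have "1 / real d \<le> C * (ln (ln n) / ln n)"
    using d2 ln0 by (simp add: field_simps)
  then show ?thesis
    using d2 dn by (auto simp: C_def B_def)
qed

theorem theorem7: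
  shows "\<exists>C::real. \<forall>n::nat. even n \<and> n \<ge> 4 \<longrightarrow>
    (\<exists>\<mu>. is_matching_strategy n \<mu> \<and>
      (\<forall>\<kappa>. is_cut_strategy n \<kappa> \<longrightarrow>
        (\<forall>t\<ge>1. lambda2 (laplacian n (matching_sum (play \<mu> \<kappa> t)))
                 \<le> C * (ln (ln (real n)) / ln (real n)) * real t)))"
proof (intro exI[of _ "17408 * (4 + ln 27 / ln (ln 4))"] allI impI)
  fix n :: nat assume n: "even n \<and> 4 \<le> n"
  then obtain d where d: "2 \<le> d" "d ^ d \<le> n"
    and le: "1 / real d \<le> (4 + ln 27 / ln (ln 4)) * (ln (ln n) / ln n)"
    using dimension_exists by blast
  \<comment> \<open>Side and dimension of the grid are both \<open>d\<close>, so this is the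
    condition that lets the smoothing term be absorbed.\<close>
  have "d \<le> d\<^sup>2" using self_le_power[of d 2] d by simp
  then obtain \<mu> where \<mu>: "is_matching_strategy n \<mu>"
    "\<And>\<kappa> t. is_cut_strategy n \<kappa> \<Longrightarrow>
      lambda2 (laplacian n (matching_sum (play \<mu> \<kappa> t))) \<le> 17408 * real t / d"
    using oblivious_strategy[of d d n] d n by auto
  have "17408 * real t / d
      \<le> 17408 * (4 + ln 27 / ln (ln 4)) * (ln (ln (real n)) / ln (real n)) * real t" for t
    using mult_left_mono[OF le, of "17408 * real t"] by (simp add: mult_ac)
  then show "\<exists>\<mu>. is_matching_strategy n \<mu> \<and>
      (\<forall>\<kappa>. is_cut_strategy n \<kappa> \<longrightarrow>
        (\<forall>t\<ge>1. lambda2 (laplacian n (matching_sum (play \<mu> \<kappa> t)))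
           \<le> 17408 * (4 + ln 27 / ln (ln 4)) * (ln (ln (real n)) / ln (real n)) * real t))"
    using \<mu> by (meson order_trans)
qed

end
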